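(* Let $\mathcal{A}$ be a hyperplane arrangement in $V$, let $H\in\mathcal{A}$, and let $$\Xi(\mathcal{A},H)=\{X\in L(\mathcal{A}^H)\mid J_{\mathcal{A}_X}^H\ne(1)\}.$$ For a subspace $X$ of $H$, let $P_X$ be the defining ideal of $X$ in $\overline S=S/(\alpha_H)$. Then: (1) $\sqrt{J_{\mathcal{A}}^H}=\bigcap_{X\in\Xi(\mathcal{A},H)}P_X$. (2) The set $\mathrm{Ass}(J_{\mathcal{A}}^H)$ of associated primes of $J_{\mathcal{A}}^H$ is contained in $\{P_X\mid X\in\Xi(\mathcal{A},H)\}$. (3) One has $$J_{\mathcal{A}}^H=\bigcap_{P_X\in\mathrm{Ass}(J_{\mathcal{A}}^H)}J_{\mathcal{A}_X}^H.$$ In particular, if $J_{\mathcal{A}}^H$ has no embedded primes, then this presentation is a primary decomposition of $J_{\mathcal{A}}^H$.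
   Context: Let $\mathbb{K}$ be a field, $V$ an $\ell$-dimensional $\mathbb{K}$-vector space, $x_1,\dots,x_\ell$ a basis of $V^*$ and $S=\mathrm{Sym}(V^* )=\mathbb{K}[x_1,\dots,x_\ell]$. An arrangement in $V$ is a finite set $\mathcal{A}$ of linear hyperplanes (through the origin) of $V$. For a hyperplane $H$, $\alpha_H\in V^*$ denotes a fixed defining linear form, and $Q(\mathcal{A})=\prod_{H\in\mathcal{A}}\alpha_H$. Let $\Omega_V^1=\bigoplus_i S\,dx_i$, $\Omega_V^2=\bigwedge^2\Omega_V^1$, and for $\alpha=\sum c_ix_i$ let $d\alpha=\sum c_i\,dx_i$. Define $$\Omega^1(\mathcal{A})=\{\omega\in \tfrac{1}{Q(\mathcal{A})}\Omega^1_V \mid Q(\mathcal{A})\,\omega\wedge d\alpha_L\in\alpha_L\Omega_V^2\ \text{for all } L\in\mathcal{A}\}.$$ For $H\in\mathcal{A}$, the restriction is $\mathcal{A}^H=\{H\cap L\mid L\in\mathcal{A},L\ne H\}$, an arrangement in $H$, whose coordinate ring is $\overline S=S/(\alpha_H)=\mathrm{Sym}(H^* )$; $\overline g$ denotes the image in $\overline S$ of $g\in S$. The residue map $\mathrm{res}^H_{\mathcal{A}}:\Omega^1(\mathcal{A})\to\overline S$ is $$\mathrm{res}^H_{\mathcal{A}}\big(f\,d\alpha_H+f_2\,d\alpha_2+\cdots+f_\ell\,d\alpha_\ell\big)=\frac{1}{Q(\mathcal{A}^H)}\,\overline{Q(\mathcal{A})f},$$ where $\alpha_H,\alpha_2,\dots,\alpha_\ell$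 is any basis of $V^*$ (this is well defined, independent of the choice of $\alpha_2,\dots,\alpha_\ell$, and takes values in $\overline S$). The residue ideal $J_{\mathcal{A}}^H\subset\overline S$ is the image of $\mathrm{res}^H_{\mathcal{A}}$. $L(\mathcal{A}^H)$ is the set of all subspaces of $H$ that are intersections of hyperplanes of $\mathcal{A}^H$ (including $H$ itself as the empty intersection). For a subspace $X\subset V$, $\mathcal{A}_X=\{L\in\mathcal{A}\mid X\subseteq L\}$; if $X\subset H$ then $H\in\mathcal{A}_X$, so $J_{\mathcal{A}_X}^H$ is an ideal of the same ring $\overline S$. Associated primes of an ideal $J\subset\overline S$ are those of $\overline S/J$; an embedded prime is an associated prime that is not minimal among the primes containing $J$. An empty intersection of ideals of $\overline S$ is $\overline S$. *)

theory Defs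
  imports
    "HOL-Library.Poly_Mapping"
    "HOL-Computational_Algebra.Polynomial_Factorial"
    "HOL-Algebra.QuotRing"
    "HOL-Algebra.Algebraic_Closure_Type"
    "HOL-Analysis.Cartesian_Space"
begin

no_notation Polynomials.var (\<open>X\<index>\<close>)

section \<open>Ideals of a commutative ring\<close>

definition ideal_radical :: "('a, 'm) ring_scheme \<Rightarrow> 'a set \<Rightarrow> 'a set" where
  "ideal_radical R J = {a \<in> carrier R. \<exists>n::nat. a [^]\<^bsub>R\<^esub> n \<in> J}"

text \<open>The primes that are annihilators of an element of the module \<open>R / J\<close>.\<close>

definition associated_primes :: "('a, 'm) ring_scheme \<Rightarrow> 'a set \<Rightarrow> 'a set set" where
  "associated_primes R J = {P. primeideal P R \<and>
     (\<exists>m \<in> carrier (R Quot J).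
        P = {r \<in> carrier R. (J +>\<^bsub>R\<^esub> r) \<otimes>\<^bsub>R Quot J\<^esub> m = \<zero>\<^bsub>R Quot J\<^esub>})}"

definition minimal_prime_over :: "('a, 'm) ring_scheme \<Rightarrow> 'a set \<Rightarrow> 'a set \<Rightarrow> bool" where
  "minimal_prime_over R J P \<longleftrightarrow> primeideal P R \<and> J \<subseteq> P \<and>
     (\<forall>P'. primeideal P' R \<and> J \<subseteq> P' \<and> P' \<subseteq> P \<longrightarrow> P' = P)"

definition embedded_primes :: "('a, 'm) ring_scheme \<Rightarrow> 'a set \<Rightarrow> 'a set set" where
  "embedded_primes R J = {P \<in> associated_primes R J. \<not> minimal_prime_over R J P}"

definition primary_ideal :: "('a, 'm) ring_scheme \<Rightarrow> 'a set \<Rightarrow> bool" where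
  "primary_ideal R I \<longleftrightarrow> ideal I R \<and> I \<noteq> carrier R \<and>
     (\<forall>a \<in> carrier R. \<forall>b \<in> carrier R. a \<otimes>\<^bsub>R\<^esub> b \<in> I \<longrightarrow> a \<in> I \<or> b \<in> ideal_radical R I)"

text \<open>Intersecting with the carrier makes the empty intersection the whole ring.\<close>

definition ideal_INT :: "('a, 'm) ring_scheme \<Rightarrow> 'i set \<Rightarrow> ('i \<Rightarrow> 'a set) \<Rightarrow> 'a set" where
  "ideal_INT R I F = carrier R \<inter> (\<Inter>i\<in>I. F i)"

definition primary_decomposition ::
    "('a, 'm) ring_scheme \<Rightarrow> 'a set \<Rightarrow> 'i set \<Rightarrow> ('i \<Rightarrow> 'a set) \<Rightarrow> bool" where
  "primary_decomposition R J I F \<longleftrightarrow>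
     finite I \<and> (\<forall>i\<in>I. primary_ideal R (F i)) \<and> J = ideal_INT R I F"


section \<open>Polynomials and linear forms\<close>

text \<open>
  The variables are indexed by a finite type \<open>'n\<close>, so \<open>\<ell> = CARD('n)\<close>. Its linear order is
  only there because the library needs it to make the polynomial ring an integral domain.
  A vector \<open>c :: 'k ^ 'n\<close> stands for the linear form with coefficients \<open>c\<close> with respect to the
  chosen basis \<open>x\<close> of the dual space.
\<close>

type_synonym ('n, 'k) pol = "('n \<Rightarrow>\<^sub>0 nat) \<Rightarrow>\<^sub>0 'k"

definition lin_form :: "('n::finite \<Rightarrow> 'v \<Rightarrow> 'k::field) \<Rightarrow> 'k ^ 'n \<Rightarrow> 'v \<Rightarrow> 'k" where
  "lin_form x c = (\<lambda>v. \<Sum>i\<in>UNIV. c $ i * x i v)"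

definition dual_basis ::
    "('k::field \<Rightarrow> 'v::ab_group_add \<Rightarrow> 'v) \<Rightarrow> ('n::finite \<Rightarrow> 'v \<Rightarrow> 'k) \<Rightarrow> bool" where
  "dual_basis scl x \<longleftrightarrow>
     (\<forall>i. Vector_Spaces.linear scl (*) (x i)) \<and>
     (\<forall>\<phi>. Vector_Spaces.linear scl (*) \<phi> \<longrightarrow> (\<exists>!c. \<phi> = lin_form x c))"

definition const_pol :: "'k::field \<Rightarrow> ('n, 'k) pol" where
  "const_pol a = Poly_Mapping.single 0 a"

definition lin_pol :: "'k::field ^ 'n::finite \<Rightarrow> ('n, 'k) pol" where
  "lin_pol c = (\<Sum>i\<in>UNIV. Poly_Mapping.single (Poly_Mapping.single i 1) (c $ i))"

abbreviation pol_ring :: "('n::finite, 'k::field) pol ring" where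
  "pol_ring \<equiv> ring_of_type_algebra"

text \<open>For \<open>a\<close> a defining form of \<open>H\<close>: the coordinate ring of \<open>H\<close> and the projection onto it.\<close>

definition coord_ring :: "'k::field ^ 'n::finite \<Rightarrow> ('n, 'k) pol set ring" where
  "coord_ring a = pol_ring Quot (PIdl\<^bsub>pol_ring\<^esub> (lin_pol a))"

definition to_coord_ring :: "'k::field ^ 'n::finite \<Rightarrow> ('n, 'k) pol \<Rightarrow> ('n, 'k) pol set" where
  "to_coord_ring a p = (PIdl\<^bsub>pol_ring\<^esub> (lin_pol a)) +>\<^bsub>pol_ring\<^esub> p"

text \<open>
  The defining ideal of a subspace is generated by linear forms; over a finite field it
  differs from the ideal of all polynomials vanishing on the points of the subspace.
\<close>

definition subspace_ideal ::
    "('n::finite \<Rightarrow> 'v \<Rightarrow> 'k::field) \<Rightarrow> 'k ^ 'n \<Rightarrow> 'v set \<Rightarrow> ('n, 'k) pol set set" where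
  "subspace_ideal x a X =
     Idl\<^bsub>coord_ring a\<^esub> {to_coord_ring a (lin_pol c) | c. \<forall>v\<in>X. lin_form x c v = 0}"


section \<open>Arrangements\<close>

definition linear_hyperplane ::
    "('k::field \<Rightarrow> 'v::ab_group_add \<Rightarrow> 'v) \<Rightarrow> 'v set \<Rightarrow> bool" where
  "linear_hyperplane scl L \<longleftrightarrow> module.subspace scl L \<and>
     vector_space.dim scl L + 1 = vector_space.dim scl UNIV"

definition arrangement ::
    "('k::field \<Rightarrow> 'v::ab_group_add \<Rightarrow> 'v) \<Rightarrow> 'v set set \<Rightarrow> bool" where
  "arrangement scl A \<longleftrightarrow> finite A \<and> (\<forall>L\<in>A. linear_hyperplane scl L)"

definition restriction :: "'v set set \<Rightarrow> 'v set \<Rightarrow> 'v set set" where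
  "restriction A H = {H \<inter> L | L. L \<in> A \<and> L \<noteq> H}"

definition restriction_flats :: "'v set set \<Rightarrow> 'v set \<Rightarrow> 'v set set" where
  "restriction_flats A H = {H \<inter> \<Inter>B | B. B \<subseteq> restriction A H}"

definition localization :: "'v set set \<Rightarrow> 'v set \<Rightarrow> 'v set set" where
  "localization A X = {L \<in> A. X \<subseteq> L}"

text \<open>
  \<open>defining_forms x U B \<gamma>\<close>: for each hyperplane \<open>Y \<in> B\<close> of the subspace \<open>U\<close>, the form
  \<open>\<gamma> Y\<close> restricts to a defining form of \<open>Y\<close> in \<open>U\<close>.
\<close>

definition defining_forms ::
    "('n::finite \<Rightarrow> 'v \<Rightarrow> 'k::field) \<Rightarrow> 'v set \<Rightarrow> 'v set set \<Rightarrow> ('v set \<Rightarrow> 'k ^ 'n) \<Rightarrow> bool" where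
  "defining_forms x U B \<gamma> \<longleftrightarrow> (\<forall>Y\<in>B. Y = {v \<in> U. lin_form x (\<gamma> Y) v = 0})"

definition defining_poly :: "('v set \<Rightarrow> 'k::field ^ 'n::finite) \<Rightarrow> 'v set set \<Rightarrow> ('n, 'k) pol" where
  "defining_poly \<gamma> B = (\<Prod>L\<in>B. lin_pol (\<gamma> L))"


section \<open>Logarithmic forms and residues\<close>

text \<open>
  A rational 1-form \<open>\<Sum>i. \<omega> i dx_i\<close> is given by its coefficients. A 2-form
  \<open>\<Sum>i<j. \<theta> i j dx_i \<and> dx_j\<close> is given by the alternating family \<open>\<theta>\<close> of its coefficients.
\<close>

type_synonym ('n, 'k) rat_form1 = "'n \<Rightarrow> ('n, 'k) pol fract"
type_synonym ('n, 'k) rat_form2 = "'n \<Rightarrow> 'n \<Rightarrow> ('n, 'k) pol fract"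

definition d_lin :: "'k::field ^ 'n::{finite,linorder} \<Rightarrow> ('n, 'k) rat_form1" where
  "d_lin c = (\<lambda>i. to_fract (const_pol (c $ i)))"

definition wedge ::
    "('n::{finite,linorder}, 'k::field) rat_form1 \<Rightarrow> ('n, 'k) rat_form1 \<Rightarrow> ('n, 'k) rat_form2" where
  "wedge \<omega> \<eta> = (\<lambda>i j. \<omega> i * \<eta> j - \<omega> j * \<eta> i)"

definition Omega1 :: "('n::{finite,linorder}, 'k::field) rat_form1 set" where
  "Omega1 = {\<lambda>i. to_fract (\<eta> i) | \<eta>. True}"

definition Omega2 :: "('n::{finite,linorder}, 'k::field) rat_form2 set" where
  "Omega2 = {\<lambda>i j. to_fract (\<theta> i j) | \<theta>. (\<forall>i. \<theta> i i = 0) \<and> (\<forall>i j. \<theta> i j = - \<theta> j i)}"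

definition log_forms ::
    "('v set \<Rightarrow> 'k::field ^ 'n::{finite,linorder}) \<Rightarrow> 'v set set \<Rightarrow> ('n, 'k) rat_form1 set" where
  "log_forms \<alpha> A = {\<omega>.
     (\<exists>\<eta>\<in>Omega1. \<omega> = (\<lambda>i. (1 / to_fract (defining_poly \<alpha> A)) * \<eta> i)) \<and>
     (\<forall>L\<in>A. \<exists>\<theta>\<in>Omega2.
        wedge (\<lambda>i. to_fract (defining_poly \<alpha> A) * \<omega> i) (d_lin (\<alpha> L))
          = (\<lambda>i j. to_fract (lin_pol (\<alpha> L)) * \<theta> i j))}"

definition basis_of_forms :: "('n::finite \<Rightarrow> 'k::field ^ 'n) \<Rightarrow> bool" where
  "basis_of_forms b \<longleftrightarrow> inj b \<and> vec.independent (b ` UNIV) \<and> vec.span (b ` UNIV) = UNIV"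

text \<open>
  Write \<open>\<omega> = \<Sum>j. f j d(b j)\<close> for a basis \<open>b\<close> of linear forms with \<open>b k = \<alpha> H\<close>. The residue is
  the element \<open>r\<close> of the coordinate ring of \<open>H\<close> whose product with the defining polynomial of
  the restriction is the image \<open>p\<close> of \<open>Q(A) f k\<close>. For logarithmic \<open>\<omega>\<close> it exists and does not
  depend on \<open>b\<close>. The argument \<open>\<beta>\<close> gives the defining forms of the restricted hyperplanes,
  lifted to the ambient space.
\<close>

definition residue ::
    "('v set \<Rightarrow> 'k::field ^ 'n::{finite,linorder}) \<Rightarrow> ('v set \<Rightarrow> 'k ^ 'n::{finite,linorder}) \<Rightarrow>
     'v set set \<Rightarrow> 'v set \<Rightarrow> ('n, 'k) rat_form1 \<Rightarrow> ('n, 'k) pol set" where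
  "residue \<alpha> \<beta> A H \<omega> = (THE r. r \<in> carrier (coord_ring (\<alpha> H)) \<and>
     (\<exists>b k f p. basis_of_forms b \<and> b k = \<alpha> H \<and>
        \<omega> = (\<lambda>i. \<Sum>j\<in>UNIV. f j * d_lin (b j) i) \<and>
        to_fract (defining_poly \<alpha> A) * f k = to_fract p \<and>
        to_coord_ring (\<alpha> H) (defining_poly \<beta> (restriction A H)) \<otimes>\<^bsub>coord_ring (\<alpha> H)\<^esub> r
          = to_coord_ring (\<alpha> H) p))"

definition residue_ideal ::
    "('v set \<Rightarrow> 'k::field ^ 'n::{finite,linorder}) \<Rightarrow> ('v set \<Rightarrow> 'k ^ 'n::{finite,linorder}) \<Rightarrow>
     'v set set \<Rightarrow> 'v set \<Rightarrow> ('n, 'k) pol set set" where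
  "residue_ideal \<alpha> \<beta> A H = residue \<alpha> \<beta> A H ` log_forms \<alpha> A"

definition Xi ::
    "('v set \<Rightarrow> 'k::field ^ 'n::{finite,linorder}) \<Rightarrow> ('v set \<Rightarrow> 'k ^ 'n::{finite,linorder}) \<Rightarrow>
     'v set set \<Rightarrow> 'v set \<Rightarrow> 'v set set" where
  "Xi \<alpha> \<beta> A H = {X \<in> restriction_flats A H.
     residue_ideal \<alpha> \<beta> (localization A X) H \<noteq> carrier (coord_ring (\<alpha> H))}"

end

(*
  Clearing denominators, a logarithmic form becomes a polynomial form eta with eta = p dh modulo the
  form h of H, and the residue is p divided by the defining polynomial of the restriction. The ideal
  N of all such p is attached to the set of defining forms alone. If these forms lie in a space W of
  linear forms, N is homogeneous for the grading of K[V] by the degree in W and the exponents of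
  complementary variables; comparing lowest terms shows that every polynomial outside the ideal (W)
  is a nonzerodivisor modulo N. Applied to A_X and W = ann X this says that J(A_X) is saturated with
  respect to the complement of P_X. Hence J(A) is contained in J(A_X), and J(A_X) is contained in P_X
  unless it is the unit ideal; conversely the product of the forms of the hyperplanes not containing X
  multiplies J(A_X) into J(A).

  These facts suffice without Noetherian arguments: the only possible associated primes are P_X, and
  for m not in J(A) a flat X that is maximal with m not in J(A_X) has P_X as an associated prime,
  because the colon ideal J(A_X) : m contains a power of every form of A_X.
*)
theory Submission
  imports Defs "HOL-Library.Option_ord"
begin

no_notation fps_nth (infixl \<open>$\<close> 75)

section \<open>Evaluation of polynomials\<close>

text \<open>Saturation with respect to the complement of P_X takes the place of localizing at P_X,
  so no local rings occur. It holds because A_X is the product of an arrangement in V/X with the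
  empty arrangement in X. To exploit this without a change of coordinates, \<open>expand\<close>
  records degrees in an outer polynomial ring whose coefficients are again elements of K[V];
  divisibility by a form of W then passes to each coefficient.

  The obstacle in comparing J(A) with J(A_X) is that their residues are divided by different
  polynomials, those of A^H and of its subset (A_X)^H. The quotient of the two lies outside P_X, so
  saturation cancels it.

  All ideals are pulled back to K[V], where they contain the form of H. Subspaces are handled
  through the forms vanishing on them, since over a finite field points do not determine
  polynomials. The passage from local information to powers in an ideal is a finite induction over
  sets of hyperplanes, in place of the Nullstellensatz.\<close>

abbreviation "lookup \<equiv> Poly_Mapping.lookup"
abbreviation "keys \<equiv> Poly_Mapping.keys"

definition unital_hom :: "('a::comm_ring_1 \<Rightarrow> 'b::comm_ring_1) \<Rightarrow> bool" where
  "unital_hom h \<longleftrightarrow> (\<forall>a b. h (a + b) = h a + h b) \<and> (\<forall>a b. h (a * b) = h a * h b) \<and> h 1 = 1"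

lemma unital_homI:
  assumes "\<And>a b. h (a + b) = h a + h b" "\<And>a b. h (a * b) = h a * h b" "h 1 = 1"
  shows "unital_hom h"
  using assms by (simp add: unital_hom_def)

context
  fixes h :: "'a::comm_ring_1 \<Rightarrow> 'b::comm_ring_1"
  assumes h: "unital_hom h"
begin

lemma unital_hom_add: "h (a + b) = h a + h b"
  and unital_hom_mult: "h (a * b) = h a * h b"
  and unital_hom_one: "h 1 = 1"
  using h by (auto simp: unital_hom_def)

lemma unital_hom_zero: "h 0 = 0"
  by (metis add_cancel_right_right unital_hom_add)

lemma unital_hom_minus: "h (a - b) = h a - h b"
  by (metis add_diff_cancel diff_add_cancel unital_hom_add)

lemma unital_hom_sum: "h (\<Sum>i\<in>I. g i) = (\<Sum>i\<in>I. h (g i))"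
  by (induction I rule: infinite_finite_induct) (simp_all add: unital_hom_zero unital_hom_add)

lemma unital_hom_prod: "h (\<Prod>i\<in>I. g i) = (\<Prod>i\<in>I. h (g i))"
  by (induction I rule: infinite_finite_induct) (simp_all add: unital_hom_one unital_hom_mult)

lemma unital_hom_power: "h (a ^ n) = h a ^ n"
  by (induction n) (simp_all add: unital_hom_one unital_hom_mult)

end

lemma unital_hom_comp: "unital_hom g \<Longrightarrow> unital_hom h \<Longrightarrow> unital_hom (\<lambda>a. g (h a))"
  by (simp add: unital_hom_def)

lemma unital_hom_const_pol: "unital_hom const_pol"
  by (intro unital_homI) (simp_all add: const_pol_def single_add mult_single)

definition monom_eval :: "('n::finite \<Rightarrow> 'r::comm_ring_1) \<Rightarrow> ('n \<Rightarrow>\<^sub>0 nat) \<Rightarrow> 'r" where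
  "monom_eval f e = (\<Prod>i\<in>UNIV. f i ^ lookup e i)"

definition pol_eval :: "('k::comm_ring_1 \<Rightarrow> 'r::comm_ring_1) \<Rightarrow> ('n::finite \<Rightarrow> 'r) \<Rightarrow> ('n, 'k) pol \<Rightarrow> 'r" where
  "pol_eval \<phi> f p = (\<Sum>e\<in>keys p. \<phi> (lookup p e) * monom_eval f e)"

definition var_pol :: "'n \<Rightarrow> ('n, 'k::field) pol" where
  "var_pol i = Poly_Mapping.single (Poly_Mapping.single i 1) 1"

lemma monom_eval_add: "monom_eval f (d + e) = monom_eval f d * monom_eval f e"
  by (simp add: monom_eval_def lookup_add power_add prod.distrib)

lemma monom_eval_zero [simp]: "monom_eval f 0 = 1"
  by (simp add: monom_eval_def)

lemma monom_eval_single: "monom_eval f (Poly_Mapping.single i 1) = f i"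
proof -
  have "monom_eval f (Poly_Mapping.single i 1) = (\<Prod>j\<in>UNIV. if j = i then f i else 1)"
    unfolding monom_eval_def by (intro prod.cong) (auto simp: lookup_single)
  then show ?thesis by simp
qed

lemma pol_eq_sum_single:
  "p = (\<Sum>e\<in>keys p. Poly_Mapping.single e (lookup p e))" for p :: "'e \<Rightarrow>\<^sub>0 'a::comm_monoid_add"
  by (rule poly_mapping_eqI)
    (simp add: lookup_sum lookup_single when_def in_keys_iff sum.delta)

lemma lin_pol_var: "lin_pol c = (\<Sum>i\<in>UNIV. const_pol (c $ i) * var_pol i)"
  by (simp add: lin_pol_def const_pol_def var_pol_def mult_single)

lemma lin_pol_add: "lin_pol (c + d) = lin_pol c + lin_pol d"
  by (simp add: lin_pol_def single_add sum.distrib)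

lemma lin_pol_scale: "lin_pol (a *s c) = const_pol a * lin_pol c"
  by (simp add: lin_pol_def const_pol_def sum_distrib_left mult_single)

lemma lin_pol_zero [simp]: "lin_pol 0 = 0"
  by (simp add: lin_pol_def)

lemma lin_pol_diff: "lin_pol (c - d) = lin_pol c - lin_pol d"
  by (metis add_diff_cancel diff_add_cancel lin_pol_add)

lemma lin_pol_axis: "lin_pol (axis i 1) = (var_pol i :: ('n::finite, 'k::field) pol)"
proof -
  have "const_pol (axis i 1 $ j) * var_pol j = (if j = i then var_pol i else 0 :: ('n, 'k) pol)" for j
    by (simp add: axis_def const_pol_def var_pol_def mult_single)
  then show ?thesis by (simp add: lin_pol_var)
qed

context
  fixes \<phi> :: "'k::comm_ring_1 \<Rightarrow> 'r::comm_ring_1"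
  assumes \<phi>: "unital_hom \<phi>"
begin

lemma pol_eval_superset:
  assumes "finite E" "keys p \<subseteq> E"
  shows "pol_eval \<phi> f p = (\<Sum>e\<in>E. \<phi> (lookup p e) * monom_eval f e)"
  unfolding pol_eval_def using assms
  by (intro sum.mono_neutral_left) (auto simp: unital_hom_zero[OF \<phi>] in_keys_iff)

lemma pol_eval_add: "pol_eval \<phi> f (p + q) = pol_eval \<phi> f p + pol_eval \<phi> f q"
proof -
  let ?E = "keys p \<union> keys q"
  have "keys (p + q) \<subseteq> ?E" by (rule keys_add)
  then show ?thesis
    by (simp add: pol_eval_superset[of ?E] lookup_add unital_hom_add[OF \<phi>] sum.distrib algebra_simps)
qed

lemma pol_eval_zero: "pol_eval \<phi> f 0 = 0"
  by (simp add: pol_eval_def)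

lemma pol_eval_sum: "pol_eval \<phi> f (\<Sum>i\<in>I. g i) = (\<Sum>i\<in>I. pol_eval \<phi> f (g i))"
  by (induction I rule: infinite_finite_induct) (simp_all add: pol_eval_zero pol_eval_add)

lemma pol_eval_single: "pol_eval \<phi> f (Poly_Mapping.single e c) = \<phi> c * monom_eval f e"
  by (subst pol_eval_superset[of "{e}"]) simp_all

lemma pol_eval_mult: "pol_eval \<phi> f (p * q) = pol_eval \<phi> f p * pol_eval \<phi> f q"
proof -
  let ?s = "\<lambda>p e. Poly_Mapping.single e (lookup p e)"
  have "pol_eval \<phi> f (p * q) = pol_eval \<phi> f ((\<Sum>d\<in>keys p. ?s p d) * (\<Sum>e\<in>keys q. ?s q e))"
    by (simp only: pol_eq_sum_single[symmetric])
  also have "\<dots> = (\<Sum>d\<in>keys p. \<Sum>e\<in>keys q. pol_eval \<phi> f (?s p d * ?s q e))"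
    by (simp add: sum_product pol_eval_sum)
  also have "\<dots> = (\<Sum>d\<in>keys p. \<Sum>e\<in>keys q. pol_eval \<phi> f (?s p d) * pol_eval \<phi> f (?s q e))"
    by (simp add: mult_single pol_eval_single monom_eval_add unital_hom_mult[OF \<phi>] mult_ac)
  also have "\<dots> = pol_eval \<phi> f p * pol_eval \<phi> f q"
    by (simp only: pol_eval_single pol_eval_def[of _ _ p] pol_eval_def[of _ _ q] sum_product)
  finally show ?thesis .
qed

lemma unital_hom_pol_eval: "unital_hom (pol_eval \<phi> f)"
proof (rule unital_homI)
  show "pol_eval \<phi> f 1 = 1"
    using pol_eval_single[of f 0 1] by (simp add: unital_hom_one[OF \<phi>])
qed (simp_all add: pol_eval_add pol_eval_mult)

end

lemma pol_eval_const: "unital_hom \<phi> \<Longrightarrow> pol_eval \<phi> f (const_pol a) = \<phi> a"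
  by (simp add: const_pol_def pol_eval_single)

lemma pol_eval_var: "unital_hom \<phi> \<Longrightarrow> pol_eval \<phi> f (var_pol i) = f i"
  using monom_eval_single[of f i] by (simp add: var_pol_def pol_eval_single unital_hom_one)

lemma pol_eval_lin: "unital_hom \<phi> \<Longrightarrow> pol_eval \<phi> f (lin_pol c) = (\<Sum>i\<in>UNIV. \<phi> (c $ i) * f i)"
  by (simp add: lin_pol_var pol_eval_sum pol_eval_mult pol_eval_const pol_eval_var)

text \<open>Substitutions are specified on coordinate forms only; semilinearity of \<open>F\<close>
  over \<open>\<phi>\<close> extends the formula to all linear forms by expansion in the standard
  basis.\<close>

lemma pol_eval_lin_additive:
  fixes F :: "'k::field ^ 'n::finite \<Rightarrow> 'r::comm_ring_1"
  assumes \<phi>: "unital_hom \<phi>"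
    and add: "\<And>c d. F (c + d) = F c + F d" and scale: "\<And>a c. F (a *s c) = \<phi> a * F c"
  shows "pol_eval \<phi> (\<lambda>i. F (axis i 1)) (lin_pol c) = F c"
proof -
  have "F 0 = 0" using scale[of 0 0] by (simp add: unital_hom_zero[OF \<phi>])
  then have sum: "F (\<Sum>i\<in>I. g i) = (\<Sum>i\<in>I. F (g i))" for I :: "'n set" and g
    by (induction I rule: infinite_finite_induct) (simp_all add: add)
  have "F c = F (\<Sum>i\<in>UNIV. (c $ i) *s axis i 1)"
    by (simp add: basis_expansion)
  then show ?thesis by (simp add: pol_eval_lin[OF \<phi>] sum scale)
qed

text \<open>Monomials are products of variables, so the values on constants and variables determine
  a homomorphism: the universal property of the polynomial ring.\<close>

lemma unital_hom_eq_pol_eval: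
  fixes h :: "('n::finite, 'k::field) pol \<Rightarrow> 'r::comm_ring_1"
  assumes h: "unital_hom h"
  shows "h p = pol_eval (\<lambda>a. h (const_pol a)) (\<lambda>i. h (var_pol i)) p"
proof -
  have "Poly_Mapping.single e c = const_pol c * monom_eval var_pol e" for e :: "'n \<Rightarrow>\<^sub>0 nat" and c :: 'k
  proof -
    have pow: "var_pol i ^ m = Poly_Mapping.single (Poly_Mapping.single i m) (1 :: 'k)" for i :: 'n and m
      by (induction m) (simp_all add: var_pol_def mult_single flip: single_add)
    have prod: "(\<Prod>i\<in>S. Poly_Mapping.single (g i) 1) = Poly_Mapping.single (\<Sum>i\<in>S. g i) (1 :: 'k)"
      for S and g :: "'n \<Rightarrow> 'n \<Rightarrow>\<^sub>0 nat"
      by (induction S rule: infinite_finite_induct) (simp_all add: mult_single)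
    have "monom_eval var_pol e = (\<Prod>i\<in>UNIV. Poly_Mapping.single (Poly_Mapping.single i (lookup e i)) (1 :: 'k))"
      by (simp add: monom_eval_def pow)
    also have "\<dots> = Poly_Mapping.single (\<Sum>i\<in>UNIV. Poly_Mapping.single i (lookup e i)) 1"
      by (rule prod)
    also have "(\<Sum>i\<in>UNIV. Poly_Mapping.single i (lookup e i)) = e"
      by (rule poly_mapping_eqI) (simp add: lookup_sum lookup_single when_def)
    finally show ?thesis by (simp add: const_pol_def mult_single)
  qed
  then have "h (Poly_Mapping.single e c) = h (const_pol c) * monom_eval (\<lambda>i. h (var_pol i)) e" for e c
    by (simp add: unital_hom_mult[OF h] monom_eval_def unital_hom_prod[OF h] unital_hom_power[OF h])
  then have "h (\<Sum>e\<in>keys p. Poly_Mapping.single e (lookup p e)) = pol_eval (\<lambda>a. h (const_pol a)) (\<lambda>i. h (var_pol i)) p"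
    by (simp only: unital_hom_sum[OF h] pol_eval_def)
  then show ?thesis by (simp only: pol_eq_sum_single[symmetric])
qed

lemma unital_hom_pol_cong:
  fixes g h :: "('n::finite, 'k::field) pol \<Rightarrow> 'r::comm_ring_1"
  assumes "unital_hom g" "unital_hom h"
    and "\<And>a. g (const_pol a) = h (const_pol a)" "\<And>i. g (var_pol i) = h (var_pol i)"
  shows "g p = h p"
proof -
  have "g p = pol_eval (\<lambda>a. h (const_pol a)) (\<lambda>i. h (var_pol i)) p"
    unfolding assms(3,4)[symmetric] by (rule unital_hom_eq_pol_eval[OF assms(1)])
  then show ?thesis by (simp only: unital_hom_eq_pol_eval[OF assms(2), of p])
qed

lemma pol_eval_id: "pol_eval const_pol var_pol p = p"
  by (rule unital_hom_pol_cong[of _ "\<lambda>p. p"])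
    (simp_all add: unital_hom_pol_eval unital_hom_const_pol pol_eval_const pol_eval_var unital_hom_def[of "\<lambda>p. p"])



section \<open>Ideals of a type-class ring\<close>

text \<open>The submodules of a ring over itself are its ideals, so \<open>span\<close> gives
  generated ideals. The simplification rule removed below is associativity oriented against
  \<open>mult.assoc\<close>.\<close>

interpretation ring_mod: Modules.module "(*) :: 'a::comm_ring_1 \<Rightarrow> 'a \<Rightarrow> 'a"
  by unfold_locales (simp_all add: algebra_simps)

declare ring_mod.scale_scale [simp del]

abbreviation is_ideal :: "'a::comm_ring_1 set \<Rightarrow> bool" where
  "is_ideal \<equiv> module.subspace (*)"

abbreviation ideal_span :: "'a::comm_ring_1 set \<Rightarrow> 'a set" where
  "ideal_span \<equiv> module.span (*)"

lemma is_ideal_mult_right: "is_ideal I \<Longrightarrow> a \<in> I \<Longrightarrow> a * b \<in> I"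
  using ring_mod.subspace_scale[of I a b] by (simp add: mult.commute)

lemma is_ideal_dvd: "is_ideal I \<Longrightarrow> a \<in> I \<Longrightarrow> a dvd b \<Longrightarrow> b \<in> I"
  by (auto simp: dvd_def intro: is_ideal_mult_right)

lemma is_ideal_multiples: "is_ideal {b. a dvd b}"
  by (simp add: ring_mod.subspace_def)

text \<open>Congruences modulo an ideal are preserved by sums and products, hence by polynomial
  expressions. It is applied to a projection of the variables modulo the forms of W, and to
  \<open>expand\<close> modulo its extra variable.\<close>

lemma pol_eval_diff_in_ideal:
  assumes \<phi>: "unital_hom \<phi>" and I: "is_ideal I" and fg: "\<And>i. f i - g i \<in> I"
  shows "pol_eval \<phi> f p - pol_eval \<phi> g p \<in> I"
proof -
  have mult: "a * b - c * d \<in> I" if "a - c \<in> I" "b - d \<in> I" for a b c d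
  proof -
    have "a * b - c * d = b * (a - c) + c * (b - d)" by (simp add: algebra_simps)
    then show ?thesis by (simp add: ring_mod.subspace_add[OF I] ring_mod.subspace_scale[OF I] that)
  qed
  have pow: "f i ^ m - g i ^ m \<in> I" for i m
    by (induction m) (auto intro!: mult fg simp: ring_mod.subspace_0[OF I])
  have prod: "(\<Prod>i\<in>S. f i ^ lookup e i) - (\<Prod>i\<in>S. g i ^ lookup e i) \<in> I" for S e
    by (induction S rule: infinite_finite_induct) (auto intro!: mult pow simp: ring_mod.subspace_0[OF I])
  have "pol_eval \<phi> f p - pol_eval \<phi> g p
      = (\<Sum>e\<in>keys p. \<phi> (lookup p e) * (monom_eval f e - monom_eval g e))"
    by (simp add: pol_eval_def sum_subtractf right_diff_distrib)
  also have "\<dots> \<in> I"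
    unfolding monom_eval_def
    by (intro ring_mod.subspace_sum[OF I] ring_mod.subspace_scale[OF I] prod)
  finally show ?thesis .
qed

section \<open>Linear algebra of forms\<close>

text \<open>\<open>\<sigma>\<close> kills a basis of \<open>W\<close> and fixes the other vectors of
  a basis extending it. It models the quotient by \<open>W\<close> inside the same space.\<close>

lemma ex_projection_with_kernel:
  fixes W :: "('k::field ^ 'n::finite) set"
  assumes W: "vec.subspace W"
  obtains \<sigma> :: "'k ^ 'n \<Rightarrow> 'k ^ 'n" where "Vector_Spaces.linear (*s) (*s) \<sigma>"
    and "\<And>c. \<sigma> c = 0 \<longleftrightarrow> c \<in> W" and "\<And>c. c - \<sigma> c \<in> W"
proof -
  obtain B where B: "B \<subseteq> W" "vec.independent B" "W \<subseteq> vec.span B"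
    using vec.maximal_independent_subset by blast
  then have spanB: "vec.span B = W"
    by (meson W subset_antisym vec.span_minimal)
  define E where "E = vec.extend_basis B"
  have E: "B \<subseteq> E" "vec.independent E" "vec.span E = UNIV"
    using B by (simp_all add: E_def vec.extend_basis_superset vec.independent_extend_basis)
  obtain \<sigma> where \<sigma>: "Vector_Spaces.linear (*s) (*s) \<sigma>" "\<And>b. b \<in> E \<Longrightarrow> \<sigma> b = (if b \<in> B then 0 else b)"
    using vec.linear_independent_extend[OF E(2), of "\<lambda>b. if b \<in> B then 0 else b"] by auto
  interpret \<sigma>: Vector_Spaces.linear "(*s)" "(*s)" \<sigma> by (rule \<sigma>(1))
  have zero: "\<sigma> c = 0" if "c \<in> W" for c
    using that unfolding spanB[symmetric]
  proof (induction rule: vec.span_induct_alt)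
    case (step a b y)
    then show ?case using E(1) \<sigma>(2)[of b] by (auto simp: \<sigma>.add \<sigma>.scale)
  qed simp
  have diff: "c - \<sigma> c \<in> W" for c
  proof -
    have "c \<in> vec.span E" by (simp add: E)
    then show ?thesis
    proof (induction rule: vec.span_induct_alt)
      case (step a b y)
      have "b - \<sigma> b \<in> W"
        using \<sigma>(2)[OF step(1)] B(1) vec.subspace_0[OF W] by auto
      moreover have "a *s b + y - \<sigma> (a *s b + y) = a *s (b - \<sigma> b) + (y - \<sigma> y)"
        by (simp add: \<sigma>.add \<sigma>.scale vec.scale_right_diff_distrib)
      ultimately show ?case
        using step(2) vec.subspace_add[OF W] vec.subspace_scale[OF W] by metis
    qed (use vec.subspace_0[OF W] in simp)
  qed
  have "c \<in> W" if "\<sigma> c = 0" for c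
    using diff[of c] that by simp
  with zero diff \<sigma>(1) that show ?thesis by blast
qed

lemma linear_functional_sum:
  fixes \<sigma> :: "'k::field ^ 'n::finite \<Rightarrow> 'k ^ 'm::finite"
  assumes "Vector_Spaces.linear (*s) (*s) \<sigma>"
  shows "\<sigma> c = (\<Sum>j\<in>UNIV. (c $ j) *s \<sigma> (axis j 1))"
proof -
  interpret Vector_Spaces.linear "(*s)" "(*s)" \<sigma> by (rule assms)
  have "\<sigma> c = \<sigma> (\<Sum>j\<in>UNIV. (c $ j) *s axis j 1)"
    by (simp add: basis_expansion)
  then show ?thesis by (simp add: sum scale)
qed

text \<open>Some coordinate of the projection with kernel \<open>W\<close> is nonzero at
  \<open>c\<close>; \<open>u\<close> collects the coefficients of that coordinate
  functional.\<close>

lemma ex_separating_vector: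
  fixes W :: "('k::field ^ 'n::finite) set"
  assumes W: "vec.subspace W" and c: "c \<notin> W"
  obtains u :: "'n \<Rightarrow> 'k" where "\<And>d. d \<in> W \<Longrightarrow> (\<Sum>j\<in>UNIV. d $ j * u j) = 0"
    and "(\<Sum>j\<in>UNIV. c $ j * u j) \<noteq> 0"
proof -
  obtain \<sigma> :: "'k ^ 'n \<Rightarrow> 'k ^ 'n" where \<sigma>: "Vector_Spaces.linear (*s) (*s) \<sigma>" "\<And>c. \<sigma> c = 0 \<longleftrightarrow> c \<in> W"
    using ex_projection_with_kernel[OF W] by metis
  then obtain i where i: "\<sigma> c $ i \<noteq> 0"
    using c by (metis vec_eq_iff zero_index)
  have "(\<Sum>j\<in>UNIV. d $ j * \<sigma> (axis j 1) $ i) = \<sigma> d $ i" for d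
    by (subst linear_functional_sum[OF \<sigma>(1), of d]) simp
  then show ?thesis
    using that[of "\<lambda>j. \<sigma> (axis j 1) $ i"] i \<sigma>(2)
    by (metis (no_types, lifting) zero_index)
qed

lemma lin_form_add: "lin_form x (c + d) v = lin_form x c v + lin_form x d v"
  and lin_form_scale: "lin_form x (a *s c) v = a * lin_form x c v"
  and lin_form_zero: "lin_form x 0 v = 0"
  by (simp_all add: lin_form_def sum.distrib sum_distrib_left algebra_simps)

section \<open>Annihilators of subspaces and common zeros of linear forms\<close>

definition annihilator :: "('n::finite \<Rightarrow> 'v \<Rightarrow> 'k::field) \<Rightarrow> 'v set \<Rightarrow> ('k ^ 'n) set" where
  "annihilator x X = {c. \<forall>v\<in>X. lin_form x c v = 0}"

lemma subspace_annihilator: "vec.subspace (annihilator x X)"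
  by (simp add: vec.subspace_def annihilator_def lin_form_add lin_form_scale lin_form_zero)

lemma annihilator_antimono: "X \<subseteq> Y \<Longrightarrow> annihilator x Y \<subseteq> annihilator x X"
  by (auto simp: annihilator_def)

context
  fixes scl :: "'k::field \<Rightarrow> 'v::ab_group_add \<Rightarrow> 'v" and x :: "'n::finite \<Rightarrow> 'v \<Rightarrow> 'k"
  assumes vs: "vector_space scl" and dual: "dual_basis scl x"
begin

text \<open>The coordinate vectors form a subspace \<open>T\<close>. If it were proper, a nonzero
  form \<open>w\<close> would vanish on it, and the zero functional would be represented by both
  \<open>w\<close> and 0, against the uniqueness in \<open>dual_basis\<close>.\<close>

lemma ex_vector_with_coordinates: "\<exists>v. \<forall>i. x i v = u i"
proof -
  interpret V: vector_space scl by (rule vs)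
  have lin: "Vector_Spaces.linear scl (*) (x i)" for i
    using dual by (simp add: dual_basis_def)
  have add: "x i (v + w) = x i v + x i w" and scale: "x i (scl a v) = a * x i v" for i v w a
    using lin[of i] by (simp_all add: Vector_Spaces.linear_iff)
  define T where "T = range (\<lambda>v. \<chi> i. x i v)"
  have T: "vec.subspace T"
    unfolding vec.subspace_def
  proof safe
    have "x i 0 = 0" for i using scale[of i 0 0] by simp
    then show "0 \<in> T" unfolding T_def by (intro image_eqI[of _ _ 0]) (simp_all add: vec_eq_iff)
  next
    fix c d assume "c \<in> T" "d \<in> T"
    then obtain v w where "c = (\<chi> i. x i v)" "d = (\<chi> i. x i w)" by (auto simp: T_def)
    then show "c + d \<in> T" unfolding T_def by (intro image_eqI[of _ _ "v + w"]) (simp_all add: vec_eq_iff add)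
  next
    fix a c assume "c \<in> T"
    then obtain v where "c = (\<chi> i. x i v)" by (auto simp: T_def)
    then show "a *s c \<in> T" unfolding T_def by (intro image_eqI[of _ _ "scl a v"]) (simp_all add: vec_eq_iff scale)
  qed
  have "(\<chi> i. u i) \<in> T"
  proof (rule ccontr)
    assume "(\<chi> i. u i) \<notin> T"
    then obtain w where w: "\<And>d. d \<in> T \<Longrightarrow> (\<Sum>j\<in>UNIV. d $ j * w j) = 0"
      "(\<Sum>j\<in>UNIV. (\<chi> i. u i) $ j * w j) \<noteq> 0"
      using ex_separating_vector[OF T] by metis
    have "lin_form x (\<chi> j. w j) v = 0" for v
      using w(1)[of "\<chi> i. x i v"] by (simp add: T_def lin_form_def mult.commute)
    moreover have "Vector_Spaces.linear scl (*) (\<lambda>v. 0 :: 'k)"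
      unfolding Vector_Spaces.linear_iff by (simp add: vs vector_space_over_itself.vector_space_axioms)
    then have "\<exists>!c. (\<lambda>v. 0) = lin_form x c"
      using dual unfolding dual_basis_def by blast
    ultimately have "(\<chi> j. w j) = (0 :: 'k ^ 'n)"
      by (metis (no_types) ext lin_form_zero)
    then show False using w(2) by (simp add: vec_eq_iff)
  qed
  then show ?thesis by (auto simp: T_def vec_eq_iff)
qed

text \<open>Double annihilator: a form outside the span of \<open>C\<close> is nonzero at some
  coordinates killed by the span, and these are realized by a vector of \<open>X\<close>.\<close>

lemma annihilator_common_zeros:
  assumes "X = {v. \<forall>c\<in>C. lin_form x c v = 0}"
  shows "annihilator x X = vec.span C"
proof
  show "vec.span C \<subseteq> annihilator x X"
    by (rule vec.span_minimal) (auto simp: subspace_annihilator, auto simp: assms annihilator_def)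
  show "annihilator x X \<subseteq> vec.span C"
  proof (rule ccontr)
    assume "\<not> annihilator x X \<subseteq> vec.span C"
    then obtain c where c: "c \<in> annihilator x X" "c \<notin> vec.span C" by blast
    obtain u where u: "\<And>d. d \<in> vec.span C \<Longrightarrow> (\<Sum>j\<in>UNIV. d $ j * u j) = 0" "(\<Sum>j\<in>UNIV. c $ j * u j) \<noteq> 0"
      using ex_separating_vector[OF vec.subspace_span c(2)] by metis
    obtain v where v: "\<And>i. x i v = u i" using ex_vector_with_coordinates by metis
    have "v \<in> X" unfolding assms using u(1) v by (auto simp: lin_form_def vec.span_base)
    then show False using c(1) u(2) v by (auto simp: annihilator_def lin_form_def)
  qed
qed

text \<open>The index set of the final intersection consists of arbitrary subspaces, which must be
  recognized as flats from their ideals. A vector outside a subspace is separated from it by a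
  functional, which is a form by \<open>dual_basis\<close>.\<close>

lemma annihilator_inject:
  assumes "module.subspace scl X" "module.subspace scl Y" "annihilator x X = annihilator x Y"
  shows "X = Y"
proof -
  interpret V: vector_space scl by (rule vs)
  interpret P: vector_space_pair scl "(*) :: 'k \<Rightarrow> 'k \<Rightarrow> 'k"
    by (simp add: vector_space_pair_def vs vector_space_over_itself.vector_space_axioms)
  have "v \<in> Z" if Z: "V.subspace Z" and v: "\<forall>c\<in>annihilator x Z. lin_form x c v = 0" for Z v
  proof (rule ccontr)
    assume "v \<notin> Z"
    obtain B where B: "B \<subseteq> Z" "V.independent B" "Z \<subseteq> V.span B"
      using V.maximal_independent_subset by blast
    then have spanB: "V.span B = Z"
      by (meson Z subset_antisym V.span_minimal)
    have ind: "V.independent (insert v B)"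
      using B(2) \<open>v \<notin> Z\<close> spanB by (simp add: V.independent_insertI)
    have "v \<notin> B" using B(1) \<open>v \<notin> Z\<close> by blast
    obtain g where g: "Vector_Spaces.linear scl (*) g" "\<forall>b\<in>insert v B. g b = (if b = v then 1 else 0)"
      using P.linear_independent_extend[OF ind, of "\<lambda>b. if b = v then 1 else 0"] by blast
    obtain c where c: "g = lin_form x c"
      using dual g(1) by (auto simp: dual_basis_def)
    interpret g: Vector_Spaces.linear scl "(*)" g by (rule g(1))
    have "g w = 0" if "w \<in> Z" for w
      using that unfolding spanB[symmetric]
    proof (induction rule: V.span_induct_alt)
      case (step a b y)
      then show ?case using bspec[OF g(2), of b] \<open>v \<notin> B\<close> by (auto simp: g.add g.scale)
    qed (rule g.zero)
    then have "c \<in> annihilator x Z" by (simp add: annihilator_def c)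
    with v have "g v = 0" by (simp add: c)
    with bspec[OF g(2), of v] show False by simp
  qed
  moreover have "\<forall>c\<in>annihilator x Z. lin_form x c v = 0" if "v \<in> Z" for v Z
    using that by (auto simp: annihilator_def)
  ultimately show ?thesis
    using assms by (metis subset_antisym subsetI)
qed

end


section \<open>Ideals generated by linear forms\<close>

definition lin_ideal :: "('k::field ^ 'n::finite) set \<Rightarrow> ('n, 'k) pol set" where
  "lin_ideal C = ideal_span (lin_pol ` C)"

lemma is_ideal_lin_ideal [simp]: "is_ideal (lin_ideal C)"
  by (simp add: lin_ideal_def)

lemma lin_ideal_base: "c \<in> C \<Longrightarrow> lin_pol c \<in> lin_ideal C"
  by (simp add: lin_ideal_def ring_mod.span_base)

lemma lin_ideal_minimal: "is_ideal I \<Longrightarrow> (\<And>c. c \<in> C \<Longrightarrow> lin_pol c \<in> I) \<Longrightarrow> lin_ideal C \<subseteq> I"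
  unfolding lin_ideal_def by (rule ring_mod.span_minimal) auto

lemma lin_ideal_mono: "C \<subseteq> D \<Longrightarrow> lin_ideal C \<subseteq> lin_ideal D"
  by (simp add: lin_ideal_def ring_mod.span_mono image_mono)

lemma lin_ideal_span: "lin_ideal (vec.span C) = lin_ideal C"
proof
  show "lin_ideal C \<subseteq> lin_ideal (vec.span C)"
    by (simp add: lin_ideal_mono vec.span_superset)
  have "lin_pol c \<in> lin_ideal C" if "c \<in> vec.span C" for c
    using that
  proof (induction rule: vec.span_induct_alt)
    case (step a b y)
    then show ?case
      by (auto simp: lin_pol_add lin_pol_scale intro!: lin_ideal_base
          ring_mod.subspace_add[OF is_ideal_lin_ideal] ring_mod.subspace_scale[OF is_ideal_lin_ideal])
  qed (simp add: ring_mod.subspace_0)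
  then show "lin_ideal (vec.span C) \<subseteq> lin_ideal C"
    by (intro lin_ideal_minimal) auto
qed

lemma lin_ideal_singleton: "lin_ideal {c} = {p. lin_pol c dvd p}"
  by (auto simp: lin_ideal_def ring_mod.span_singleton dvd_def mult.commute)

lemma lookup_lin_pol: "lookup (lin_pol c) (Poly_Mapping.single i 1) = c $ i"
proof -
  have "j = i" if "Poly_Mapping.single j (Suc 0) = Poly_Mapping.single i (Suc 0)" for j
    using arg_cong[OF that, of keys] by simp
  then have "lookup (lin_pol c) (Poly_Mapping.single i 1) = (\<Sum>j\<in>UNIV. if j = i then c $ i else 0)"
    unfolding lin_pol_def lookup_sum by (intro sum.cong) (auto simp: lookup_single when_def)
  then show ?thesis by simp
qed

lemma lin_pol_eq_0_iff [simp]: "lin_pol c = 0 \<longleftrightarrow> c = 0"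
proof
  assume "lin_pol c = 0"
  then show "c = 0"
    using lookup_lin_pol[of c] by (simp add: vec_eq_iff)
qed simp

text \<open>Modulo the ideal of \<open>W\<close> every variable, hence every \<open>p\<close>, is
  congruent to its image under the substitution, which in turn kills the generators. Thus the
  quotient by \<open>lin_ideal W\<close> embeds in the polynomial ring itself, where primality and
  membership of linear forms can be read off.\<close>

lemma lin_ideal_kernel:
  fixes W :: "('k::field ^ 'n::finite) set"
  assumes W: "vec.subspace W"
  obtains \<sigma> :: "'k ^ 'n \<Rightarrow> 'k ^ 'n"
  where "Vector_Spaces.linear (*s) (*s) \<sigma>"
    and "\<And>c. pol_eval const_pol (\<lambda>i. lin_pol (\<sigma> (axis i 1))) (lin_pol c) = lin_pol (\<sigma> c)"
    and "\<And>p. p \<in> lin_ideal W \<longleftrightarrow> pol_eval const_pol (\<lambda>i. lin_pol (\<sigma> (axis i 1))) p = 0"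
    and "\<And>c. \<sigma> c = 0 \<longleftrightarrow> c \<in> W" and "\<And>c. c - \<sigma> c \<in> W"
proof -
  obtain \<sigma> :: "'k ^ 'n \<Rightarrow> 'k ^ 'n" where \<sigma>: "Vector_Spaces.linear (*s) (*s) \<sigma>" "\<And>c. \<sigma> c = 0 \<longleftrightarrow> c \<in> W" "\<And>c. c - \<sigma> c \<in> W"
    using ex_projection_with_kernel[OF W] by metis
  define \<pi> where "\<pi> = pol_eval const_pol (\<lambda>i. lin_pol (\<sigma> (axis i 1)))"
  have hom: "unital_hom \<pi>" unfolding \<pi>_def by (intro unital_hom_pol_eval unital_hom_const_pol)
  interpret \<sigma>: Vector_Spaces.linear "(*s)" "(*s)" \<sigma> by (rule \<sigma>(1))
  have lin: "\<pi> (lin_pol c) = lin_pol (\<sigma> c)" for c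
    unfolding \<pi>_def
    by (rule pol_eval_lin_additive[OF unital_hom_const_pol, of "\<lambda>c. lin_pol (\<sigma> c)"])
      (simp_all add: \<sigma>.add \<sigma>.scale lin_pol_add lin_pol_scale)
  have "p - \<pi> p \<in> lin_ideal W" for p
  proof -
    have "pol_eval const_pol var_pol p - \<pi> p \<in> lin_ideal W"
      unfolding \<pi>_def
    proof (rule pol_eval_diff_in_ideal[OF unital_hom_const_pol is_ideal_lin_ideal])
      fix i
      show "var_pol i - lin_pol (\<sigma> (axis i 1)) \<in> lin_ideal W"
        using lin_ideal_base[OF \<sigma>(3)[of "axis i 1"]] by (simp add: lin_pol_diff lin_pol_axis)
    qed
    then show ?thesis by (simp add: pol_eval_id)
  qed
  moreover have "\<pi> p = 0" if "p \<in> lin_ideal W" for p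
  proof -
    have "is_ideal {p. \<pi> p = 0}"
      by (simp add: ring_mod.subspace_def unital_hom_zero[OF hom] unital_hom_add[OF hom] unital_hom_mult[OF hom])
    then have "lin_ideal W \<subseteq> {p. \<pi> p = 0}"
      by (rule lin_ideal_minimal) (simp add: lin \<sigma>)
    then show ?thesis using that by blast
  qed
  ultimately have "p \<in> lin_ideal W \<longleftrightarrow> \<pi> p = 0" for p
    by (metis diff_zero)
  with lin \<sigma> that show ?thesis unfolding \<pi>_def by blast
qed

lemma lin_pol_in_lin_ideal: "vec.subspace W \<Longrightarrow> lin_pol c \<in> lin_ideal W \<longleftrightarrow> c \<in> W"
  by (erule lin_ideal_kernel) simp

lemma one_notin_lin_ideal: "vec.subspace W \<Longrightarrow> 1 \<notin> lin_ideal W"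
  by (erule lin_ideal_kernel) (simp add: unital_hom_one[OF unital_hom_pol_eval] unital_hom_const_pol)

lemma lin_ideal_prime:
  fixes W :: "('k::field ^ 'n::{finite,linorder}) set"
  assumes "vec.subspace W" "a * b \<in> lin_ideal W"
  shows "a \<in> lin_ideal W \<or> b \<in> lin_ideal W"
  using assms(2)
  by (rule_tac lin_ideal_kernel[OF assms(1)])
    (simp add: unital_hom_mult[OF unital_hom_pol_eval] unital_hom_const_pol)

lemma lin_ideal_prod:
  fixes W :: "('k::field ^ 'n::{finite,linorder}) set"
  assumes W: "vec.subspace W" and "finite I" "(\<Prod>i\<in>I. g i) \<in> lin_ideal W"
  shows "\<exists>i\<in>I. g i \<in> lin_ideal W"
  using assms(2,3)
  by (induction I) (auto simp: one_notin_lin_ideal[OF W] dest: lin_ideal_prime[OF W])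

lemma lin_pol_dvd_mult:
  fixes c :: "'k::field ^ 'n::{finite,linorder}"
  assumes "lin_pol c dvd a * b"
  shows "lin_pol c dvd a \<or> lin_pol c dvd b"
  using lin_ideal_prime[OF vec.subspace_span, of a b "{c}"] assms
  by (simp add: lin_ideal_span lin_ideal_singleton)

section \<open>Numerators of residues\<close>

text \<open>
  Multiplying by the defining polynomial turns logarithmic forms into polynomial forms \<open>\<eta>\<close>.
  Modulo the form \<open>h\<close> of the distinguished hyperplane, such an \<open>\<eta>\<close> is a multiple \<open>p dh\<close>; the
  residue is \<open>p\<close> divided by the defining polynomial of the restriction.
\<close>

definition log_numerators :: "('k::field ^ 'n::finite) set \<Rightarrow> ('n \<Rightarrow> ('n, 'k) pol) set" where
  "log_numerators C = {\<eta>. \<forall>c\<in>C. \<forall>i j.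
     lin_pol c dvd \<eta> i * const_pol (c $ j) - \<eta> j * const_pol (c $ i)}"

definition residue_numerators :: "('k::field ^ 'n::finite) set \<Rightarrow> 'k ^ 'n \<Rightarrow> ('n, 'k) pol set" where
  "residue_numerators C h = {p. \<exists>\<eta>\<in>log_numerators C. \<forall>i. lin_pol h dvd \<eta> i - p * const_pol (h $ i)}"

lemma log_numerators_zero: "(\<lambda>i. 0) \<in> log_numerators C"
  by (simp add: log_numerators_def)

lemma residue_numeratorsI:
  "\<eta> \<in> log_numerators C \<Longrightarrow> (\<And>i. lin_pol h dvd \<eta> i - p * const_pol (h $ i)) \<Longrightarrow> p \<in> residue_numerators C h"
  by (auto simp: residue_numerators_def)

lemma residue_numeratorsE:
  assumes "p \<in> residue_numerators C h"
  obtains \<eta> where "\<eta> \<in> log_numerators C" "\<And>i. lin_pol h dvd \<eta> i - p * const_pol (h $ i)"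
  using assms by (auto simp: residue_numerators_def)

lemma log_numerators_add:
  fixes C :: "('k::field ^ 'n::finite) set"
  shows "\<eta> \<in> log_numerators C \<Longrightarrow> \<theta> \<in> log_numerators C \<Longrightarrow> (\<lambda>i. \<eta> i + \<theta> i) \<in> log_numerators C"
proof -
  have "d dvd (a + a') * s - (b + b') * t" if "d dvd a * s - b * t" "d dvd a' * s - b' * t"
    for a a' b b' s t d :: "('n, 'k) pol"
    using dvd_add[OF that] by (simp add: algebra_simps)
  then show "\<eta> \<in> log_numerators C \<Longrightarrow> \<theta> \<in> log_numerators C \<Longrightarrow> ?thesis"
    by (simp add: log_numerators_def)
qed

lemma log_numerators_scale:
  fixes C :: "('k::field ^ 'n::finite) set"
  shows "\<eta> \<in> log_numerators C \<Longrightarrow> (\<lambda>i. a * \<eta> i) \<in> log_numerators C"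
proof -
  have "d dvd a * b * s - a * c * t" if "d dvd b * s - c * t" for b c s t d :: "('n, 'k) pol"
    using dvd_mult[OF that, of a] by (simp add: algebra_simps)
  then show "\<eta> \<in> log_numerators C \<Longrightarrow> ?thesis"
    by (simp add: log_numerators_def)
qed

lemma log_numerators_antimono: "C \<subseteq> D \<Longrightarrow> log_numerators D \<subseteq> log_numerators C"
  by (auto simp: log_numerators_def)

lemma residue_numerators_antimono:
  assumes "C \<subseteq> D" shows "residue_numerators D h \<subseteq> residue_numerators C h"
proof
  fix p assume "p \<in> residue_numerators D h"
  then obtain \<eta> where \<eta>: "\<eta> \<in> log_numerators D" "\<And>i. lin_pol h dvd \<eta> i - p * const_pol (h $ i)"
    by (rule residue_numeratorsE) blast
  then show "p \<in> residue_numerators C h"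
    using subsetD[OF log_numerators_antimono[OF assms] \<eta>(1)] by (intro residue_numeratorsI)
qed

lemma is_ideal_residue_numerators: "is_ideal (residue_numerators C h)"
  unfolding ring_mod.subspace_def
proof safe
  show "0 \<in> residue_numerators C h"
    by (rule residue_numeratorsI[OF log_numerators_zero]) simp
next
  fix p q assume "p \<in> residue_numerators C h" "q \<in> residue_numerators C h"
  then obtain \<eta> \<theta> where \<eta>: "\<eta> \<in> log_numerators C" "\<And>i. lin_pol h dvd \<eta> i - p * const_pol (h $ i)"
    and \<theta>: "\<theta> \<in> log_numerators C" "\<And>i. lin_pol h dvd \<theta> i - q * const_pol (h $ i)"
    by (auto simp: residue_numerators_def)
  have "lin_pol h dvd (\<eta> i + \<theta> i) - (p + q) * const_pol (h $ i)" for i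
    using dvd_add[OF \<eta>(2) \<theta>(2), of i] by (simp add: algebra_simps)
  then show "p + q \<in> residue_numerators C h"
    by (rule residue_numeratorsI[OF log_numerators_add[OF \<eta>(1) \<theta>(1)]])
next
  fix a p assume "p \<in> residue_numerators C h"
  then obtain \<eta> where \<eta>: "\<eta> \<in> log_numerators C" "\<And>i. lin_pol h dvd \<eta> i - p * const_pol (h $ i)"
    by (auto simp: residue_numerators_def)
  have "lin_pol h dvd a * \<eta> i - (a * p) * const_pol (h $ i)" for i
    using dvd_mult[OF \<eta>(2), of a i] by (simp add: algebra_simps)
  then show "a * p \<in> residue_numerators C h"
    by (rule residue_numeratorsI[OF log_numerators_scale[OF \<eta>(1)]])
qed

text \<open>Witnessed by the zero form. It makes the ideal the full preimage of its image modulo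
  \<open>h\<close>.\<close>

lemma lin_pol_in_residue_numerators: "lin_pol h \<in> residue_numerators C h"
  by (rule residue_numeratorsI[OF log_numerators_zero]) simp

text \<open>Multiplying a polynomial form by \<open>q\<close> enforces the conditions at the forms
  dividing \<open>q\<close> and preserves all others.\<close>

lemma residue_numerators_mult_forms:
  assumes q: "\<And>c. c \<in> D \<Longrightarrow> lin_pol c dvd q" and "p \<in> residue_numerators C h"
  shows "q * p \<in> residue_numerators (C \<union> D) h"
proof -
  obtain \<eta> where \<eta>: "\<eta> \<in> log_numerators C" "\<And>i. lin_pol h dvd \<eta> i - p * const_pol (h $ i)"
    using assms(2) by (rule residue_numeratorsE) blast
  show ?thesis
  proof (rule residue_numeratorsI)
    show "(\<lambda>i. q * \<eta> i) \<in> log_numerators (C \<union> D)"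
      using log_numerators_scale[OF \<eta>(1), of q] q
      by (auto simp: log_numerators_def dvd_diff)
    show "lin_pol h dvd q * \<eta> i - (q * p) * const_pol (h $ i)" for i
      using dvd_mult[OF \<eta>(2), of q i] by (simp add: algebra_simps)
  qed
qed

subsection \<open>Graded pieces\<close>

lemma lookup_single_zero_mult:
  "lookup (Poly_Mapping.single 0 s * Q) e = s * lookup Q e" for Q :: "'g::comm_monoid_add \<Rightarrow>\<^sub>0 'a::comm_ring_1"
  by (simp add: Poly_Mapping.map.rep_eq when_def flip: mult_map_scale_conv_mult)

lemma lookup_mult_sum:
  fixes A B :: "'g::comm_monoid_add \<Rightarrow>\<^sub>0 'a::comm_ring_1"
  shows "lookup (A * B) k = (\<Sum>(a, b)\<in>keys A \<times> keys B. lookup A a * lookup B b when a + b = k)"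
proof -
  have "A * B = (\<Sum>a\<in>keys A. Poly_Mapping.single a (lookup A a)) * (\<Sum>b\<in>keys B. Poly_Mapping.single b (lookup B b))"
    by (simp only: pol_eq_sum_single[symmetric])
  also have "\<dots> = (\<Sum>(a, b)\<in>keys A \<times> keys B. Poly_Mapping.single (a + b) (lookup A a * lookup B b))"
    by (simp only: sum_product mult_single sum.cartesian_product)
  finally show ?thesis
    by (simp add: lookup_sum lookup_single case_prod_unfold)
qed

text \<open>As in Gauss's lemma: if \<open>e\<close> is the least exponent at which the coefficient
  of \<open>P\<close> is outside \<open>N\<close>, the coefficient of \<open>A * P\<close> at
  \<open>m + e\<close> is a unit times that coefficient plus elements of \<open>N\<close>.\<close>

lemma coeffs_in_ideal_if_lowest_unit:
  fixes A P :: "'g::{ordered_cancel_comm_monoid_add, linorder} \<Rightarrow>\<^sub>0 'a::comm_ring_1"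
  assumes N: "is_ideal N" and low: "\<And>d. d \<in> keys A \<Longrightarrow> m \<le> d"
    and unit: "lookup A m dvd 1" and AP: "\<And>d. lookup (A * P) d \<in> N"
  shows "lookup P d \<in> N"
proof (rule ccontr)
  assume "lookup P d \<notin> N"
  define bad where "bad = {e \<in> keys P. lookup P e \<notin> N}"
  have "d \<in> keys P" using \<open>lookup P d \<notin> N\<close> ring_mod.subspace_0[OF N] by (auto simp: in_keys_iff)
  then have bad: "finite bad" "bad \<noteq> {}"
    using \<open>lookup P d \<notin> N\<close> by (auto simp: bad_def)
  define e where "e = Min bad"
  have e: "e \<in> keys P" "lookup P e \<notin> N"
    using Min_in[OF bad] by (auto simp: e_def bad_def)
  have less: "lookup P b \<in> N" if "b < e" for b
  proof (rule ccontr)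
    assume *: "lookup P b \<notin> N"
    then have "b \<in> bad" using ring_mod.subspace_0[OF N] by (auto simp: bad_def in_keys_iff)
    then show False using Min_le[OF bad(1), of b] that by (simp add: e_def)
  qed
  let ?t = "\<lambda>(a, b). lookup A a * lookup P b when a + b = m + e"
  have m: "m \<in> keys A"
    using unit e(2) ring_mod.subspace_scale[OF N] ring_mod.subspace_0[OF N]
    by (metis dvdE in_keys_iff mult_1 mult_zero_left)
  have "?t z \<in> N" if "z \<in> keys A \<times> keys P - {(m, e)}" for z
  proof -
    obtain a b where z: "z = (a, b)" by (cases z)
    \<comment> \<open>In any other pair with this sum \<open>a\<close> exceeds the minimum
      \<open>m\<close>, so \<open>b\<close> lies below \<open>e\<close> and its coefficient is
      already in \<open>N\<close>.\<close>
    have "b < e" if "a + b = m + e"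
    proof (rule ccontr)
      assume "\<not> b < e"
      moreover have "m \<le> a" using low that \<open>z \<in> _\<close> z by auto
      moreover have "m \<noteq> a"
        using that \<open>z \<in> _\<close> z by auto
      ultimately have "m + e < a + b"
        by (intro add_less_le_mono) auto
      then show False using that by simp
    qed
    then show ?thesis
      using less ring_mod.subspace_scale[OF N] ring_mod.subspace_0[OF N] by (auto simp: z when_def)
  qed
  then have rest: "(\<Sum>z\<in>keys A \<times> keys P - {(m, e)}. ?t z) \<in> N"
    by (rule ring_mod.subspace_sum[OF N])
  have "lookup (A * P) (m + e) = ?t (m, e) + (\<Sum>z\<in>keys A \<times> keys P - {(m, e)}. ?t z)"
    unfolding lookup_mult_sum using m e(1) by (intro sum.remove) auto
  then have "lookup A m * lookup P e = lookup (A * P) (m + e) - (\<Sum>z\<in>keys A \<times> keys P - {(m, e)}. ?t z)"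
    by simp
  then have "lookup A m * lookup P e \<in> N"
    using ring_mod.subspace_diff[OF N AP rest] by simp
  moreover obtain u where "1 = lookup A m * u"
    using unit by (auto simp: dvd_def)
  then have "lookup P e = u * (lookup A m * lookup P e)"
    by (metis mult.assoc mult.commute mult_1)
  ultimately show False
    using e(2) ring_mod.subspace_scale[OF N] by metis
qed

text \<open>Exponents are ordered lexicographically and \<open>None\<close> is the least variable,
  so it is compared before all others. A lowest monomial therefore has the lowest degree in the
  forms of W.\<close>

lemma lookup_None_mono:
  fixes d e :: "'n::linorder option \<Rightarrow>\<^sub>0 nat"
  assumes "d \<le> e" shows "lookup d None \<le> lookup e None"
proof -
  have "d = e \<or> less_fun (lookup d) (lookup e)"
    using assms by (auto simp: less_eq_poly_mapping.rep_eq lookup_inject)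
  then show ?thesis
  proof
    assume "less_fun (lookup d) (lookup e)"
    then obtain k where k: "lookup d k < lookup e k" "\<And>k'. k' < k \<Longrightarrow> lookup d k' = lookup e k'"
      by (auto simp: less_fun_def)
    then show ?thesis by (cases k) auto
  qed simp
qed



section \<open>Expansion along a projection of linear forms\<close>

lemma unital_hom_single: "unital_hom (\<lambda>a :: 'a::comm_ring_1. Poly_Mapping.single (0 :: 'g::comm_monoid_add) a)"
  by (intro unital_homI) (simp_all add: single_add mult_single)

text \<open>
  The expansion of \<open>p\<close> with respect to the splitting \<open>c = (c - \<sigma> c) + \<sigma> c\<close> of the linear forms
  into the kernel and the image of the projection \<open>\<sigma>\<close>. The exponent of \<open>None\<close> is the degree in the
  forms of the kernel, whereas the forms in the image become forms in the variables \<open>Some i\<close>.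
\<close>

definition expand ::
    "('k::field ^ 'n::finite \<Rightarrow> 'k ^ 'n) \<Rightarrow> ('n, 'k) pol \<Rightarrow> (('n option \<Rightarrow>\<^sub>0 nat) \<Rightarrow>\<^sub>0 ('n, 'k) pol)" where
  "expand \<sigma> = pol_eval (\<lambda>a. Poly_Mapping.single 0 (const_pol a)) (\<lambda>i.
     Poly_Mapping.single (Poly_Mapping.single None 1) (lin_pol (axis i 1 - \<sigma> (axis i 1))) +
     (\<Sum>j\<in>UNIV. Poly_Mapping.single (Poly_Mapping.single (Some j) 1) (const_pol (\<sigma> (axis i 1) $ j))))"

text \<open>This is \<open>expand\<close> for the identity projection. Composed with a projection it
  describes the part of \<open>expand\<close> of degree 0 in \<open>None\<close>.\<close>

definition expand0 :: "('n::finite, 'k::field) pol \<Rightarrow> (('n option \<Rightarrow>\<^sub>0 nat) \<Rightarrow>\<^sub>0 ('n, 'k) pol)" where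
  "expand0 = pol_eval (\<lambda>a. Poly_Mapping.single 0 (const_pol a))
     (\<lambda>i. Poly_Mapping.single (Poly_Mapping.single (Some i) 1) 1)"

text \<open>Summing the graded pieces again: a left inverse of both expansions.\<close>

definition collapse :: "(('n::finite option \<Rightarrow>\<^sub>0 nat) \<Rightarrow>\<^sub>0 ('n, 'k::field) pol) \<Rightarrow> ('n, 'k) pol" where
  "collapse = pol_eval (\<lambda>p. p) (case_option 1 var_pol)"

lemma unital_hom_id: "unital_hom (\<lambda>p. p)"
  by (simp add: unital_hom_def)

lemma unital_hom_single_const: "unital_hom (\<lambda>a. Poly_Mapping.single 0 (const_pol a))"
  by (rule unital_hom_comp[OF unital_hom_single unital_hom_const_pol])

lemma unital_hom_expand: "unital_hom (expand \<sigma>)"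
  and unital_hom_expand0: "unital_hom expand0"
  and unital_hom_collapse: "unital_hom collapse"
  unfolding expand_def expand0_def collapse_def
  by (rule unital_hom_pol_eval[OF unital_hom_single_const] unital_hom_pol_eval[OF unital_hom_id])+

lemma collapse_single: "collapse (Poly_Mapping.single e p) = p * monom_eval (case_option 1 var_pol) e"
  by (simp add: collapse_def pol_eval_single unital_hom_id)

lemma collapse_single_single: "collapse (Poly_Mapping.single (Poly_Mapping.single i (Suc 0)) p) = p * case_option 1 var_pol i"
  by (simp add: collapse_single monom_eval_single[simplified])

lemma collapse_sum: "collapse (\<Sum>i\<in>I. g i) = (\<Sum>i\<in>I. collapse (g i))"
  by (rule unital_hom_sum[OF unital_hom_collapse])

lemma collapse_add: "collapse (p + q) = collapse p + collapse q"
  by (rule unital_hom_add[OF unital_hom_collapse])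

lemma collapse_expand: "collapse (expand \<sigma> p) = p"
proof (rule unital_hom_pol_cong[of "\<lambda>p. collapse (expand \<sigma> p)" "\<lambda>p. p"])
  show "unital_hom (\<lambda>p. collapse (expand \<sigma> p))"
    by (rule unital_hom_comp[OF unital_hom_collapse unital_hom_expand])
  show "collapse (expand \<sigma> (const_pol a)) = const_pol a" for a
    by (simp add: expand_def pol_eval_const[OF unital_hom_single_const] collapse_single)
  show "collapse (expand \<sigma> (var_pol i)) = var_pol i" for i
    by (simp add: expand_def pol_eval_var[OF unital_hom_single_const] collapse_single_single
        collapse_add collapse_sum lin_pol_diff lin_pol_axis flip: lin_pol_var)
qed (rule unital_hom_id)

lemma collapse_expand0: "collapse (expand0 p) = p"
proof (rule unital_hom_pol_cong[of "\<lambda>p. collapse (expand0 p)" "\<lambda>p. p"])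
  show "unital_hom (\<lambda>p. collapse (expand0 p))"
    by (rule unital_hom_comp[OF unital_hom_collapse unital_hom_expand0])
  show "collapse (expand0 (const_pol a)) = const_pol a" for a
    by (simp add: expand0_def pol_eval_const[OF unital_hom_single_const] collapse_single)
  show "collapse (expand0 (var_pol i)) = var_pol i" for i
    by (simp add: expand0_def pol_eval_var[OF unital_hom_single_const] collapse_single_single)
qed (rule unital_hom_id)

lemma collapse_in_ideal:
  assumes "is_ideal N" "\<And>e. lookup P e \<in> N"
  shows "collapse P \<in> N"
  unfolding collapse_def pol_eval_def
  by (intro ring_mod.subspace_sum is_ideal_mult_right assms)

text \<open>Monomials are only renamed and keep coefficients in the field. A nonzero coefficient is
  therefore a unit, as the comparison of lowest terms requires.\<close>

lemma lookup_expand0: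
  fixes p :: "('n::finite, 'k::field) pol"
  shows "lookup (expand0 p) e \<in> range const_pol"
    and "lookup e None \<noteq> 0 \<Longrightarrow> lookup (expand0 p) e = 0"
proof -
  define s :: "('n \<Rightarrow>\<^sub>0 nat) \<Rightarrow> 'n option \<Rightarrow>\<^sub>0 nat"
    where "s d = (\<Sum>i\<in>UNIV. Poly_Mapping.single (Some i) (lookup d i))" for d
  have pow: "Poly_Mapping.single (Poly_Mapping.single k 1) 1 ^ m = Poly_Mapping.single (Poly_Mapping.single k m) (1 :: ('n, 'k) pol)"
    for k :: "'n option" and m
    by (induction m) (simp_all add: mult_single flip: single_add)
  have prod: "(\<Prod>i\<in>S. Poly_Mapping.single (g i) 1) = Poly_Mapping.single (\<Sum>i\<in>S. g i) (1 :: ('n, 'k) pol)"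
    for S :: "'n set" and g :: "'n \<Rightarrow> 'n option \<Rightarrow>\<^sub>0 nat"
    by (induction S rule: infinite_finite_induct) (simp_all add: mult_single)
  have "monom_eval (\<lambda>i. Poly_Mapping.single (Poly_Mapping.single (Some i) 1) 1) d = Poly_Mapping.single (s d) (1 :: ('n, 'k) pol)" for d
    by (simp only: monom_eval_def pow prod s_def)
  then have eq: "lookup (expand0 p) e = (\<Sum>d\<in>keys p. const_pol (lookup p d) when s d = e)"
    by (simp add: expand0_def pol_eval_def mult_single lookup_sum lookup_single)
  also have "\<dots> = const_pol (\<Sum>d\<in>keys p. lookup p d when s d = e)"
    unfolding unital_hom_sum[OF unital_hom_const_pol]
    by (intro sum.cong) (auto simp: when_def unital_hom_zero[OF unital_hom_const_pol])
  finally show "lookup (expand0 p) e \<in> range const_pol" by blast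
  have "lookup (s d) None = 0" for d
    by (simp add: s_def lookup_sum lookup_single)
  then show "lookup (expand0 p) e = 0" if "lookup e None \<noteq> 0"
    unfolding eq using that by (intro sum.neutral) (auto simp: when_def)
qed

lemma lookup_single_mult_None:
  fixes Q :: "('n option \<Rightarrow>\<^sub>0 nat) \<Rightarrow>\<^sub>0 'a::comm_ring_1"
  assumes "lookup e None = 0"
  shows "lookup (Poly_Mapping.single (Poly_Mapping.single None 1) a * Q) e = 0"
proof -
  have "Poly_Mapping.single None 1 + d \<noteq> e" for d
  proof
    assume "Poly_Mapping.single None 1 + d = e"
    then have "1 + lookup d None = lookup e None" by (metis lookup_add lookup_single_eq)
    then show False using assms by simp
  qed
  then show ?thesis
    by (auto simp: lookup_mult_sum when_def intro!: sum.neutral split: if_splits)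
qed

context
  fixes W :: "('k::field ^ 'n::finite) set" and \<sigma> :: "'k ^ 'n \<Rightarrow> 'k ^ 'n"
  assumes \<sigma>: "Vector_Spaces.linear (*s) (*s) \<sigma>" and ker: "\<And>c. \<sigma> c = 0 \<longleftrightarrow> c \<in> W"
begin

interpretation \<sigma>: Vector_Spaces.linear "(*s)" "(*s)" \<sigma> by (rule \<sigma>)

text \<open>Since \<open>\<sigma>\<close> kills the forms of \<open>W\<close>, they have no part in
  the variables \<open>Some j\<close>.\<close>

lemma expand_lin_pol:
  assumes "c \<in> W"
  shows "expand \<sigma> (lin_pol c) = Poly_Mapping.single (Poly_Mapping.single None 1) (lin_pol c)"
proof -
  let ?F = "\<lambda>c. Poly_Mapping.single (Poly_Mapping.single None 1) (lin_pol (c - \<sigma> c)) +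
     (\<Sum>j\<in>UNIV. Poly_Mapping.single (Poly_Mapping.single (Some j) 1) (const_pol (\<sigma> c $ j)))"
  have "?F (a *s c) = Poly_Mapping.single 0 (const_pol a) * ?F c" for a c
  proof -
    have "a *s c - a *s \<sigma> c = a *s (c - \<sigma> c)" by (simp add: vec.scale_right_diff_distrib)
    then show ?thesis
      by (simp add: \<sigma>.scale lin_pol_scale distrib_left sum_distrib_left mult_single unital_hom_mult[OF unital_hom_const_pol])
  qed
  moreover have "?F (c + d) = ?F c + ?F d" for c d
  proof -
    have "c + d - (\<sigma> c + \<sigma> d) = (c - \<sigma> c) + (d - \<sigma> d)" by simp
    then show ?thesis
      by (simp only: \<sigma>.add lin_pol_add single_add vector_add_component unital_hom_add[OF unital_hom_const_pol] sum.distrib add_ac)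
  qed
  ultimately have "expand \<sigma> (lin_pol c) = ?F c"
    unfolding expand_def by (intro pol_eval_lin_additive[OF unital_hom_single_const, of ?F])
  moreover have "\<sigma> c = 0" using assms ker by simp
  ultimately show ?thesis by (simp add: unital_hom_zero[OF unital_hom_const_pol])
qed

text \<open>By multiplicativity, the expansion of a multiple of \<open>lin_pol c\<close> is this
  form, as a coefficient, times another polynomial. This is why the coefficients are taken in the
  polynomial ring and not in the field.\<close>

lemma dvd_lookup_expand:
  assumes "c \<in> W" "lin_pol c dvd g"
  shows "lin_pol c dvd lookup (expand \<sigma> g) e"
proof -
  obtain q where "g = lin_pol c * q" using assms(2) by (auto simp: dvd_def)
  then have "expand \<sigma> g = Poly_Mapping.single (0 + Poly_Mapping.single None 1) (lin_pol c * 1) * expand \<sigma> q"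
    using assms(1) by (simp add: unital_hom_mult[OF unital_hom_expand] expand_lin_pol)
  then have "expand \<sigma> g = Poly_Mapping.single 0 (lin_pol c) * (Poly_Mapping.single (Poly_Mapping.single None 1) 1 * expand \<sigma> q)"
    by (simp only: mult_single[symmetric] mult.assoc)
  then show ?thesis by (simp only: lookup_single_zero_mult dvd_triv_left)
qed

lemma lookup_expand_mult_const: "lookup (expand \<sigma> (g * const_pol a)) e = lookup (expand \<sigma> g) e * const_pol a"
proof -
  have "expand \<sigma> (const_pol a) = Poly_Mapping.single 0 (const_pol a)"
    by (simp add: expand_def pol_eval_const[OF unital_hom_single_const])
  then have "expand \<sigma> (g * const_pol a) = Poly_Mapping.single 0 (const_pol a) * expand \<sigma> g"
    by (simp add: unital_hom_mult[OF unital_hom_expand] mult.commute)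
  then have "lookup (expand \<sigma> (g * const_pol a)) e = const_pol a * lookup (expand \<sigma> g) e"
    by (simp only: lookup_single_zero_mult)
  then show ?thesis by (simp only: mult.commute)
qed

text \<open>The conditions say that combinations of \<open>\<eta>\<close> and \<open>p\<close> with
  constant coefficients are divisible by forms of \<open>W\<close>; hence they hold for each piece
  separately. This is the homogeneity of the ideal.\<close>

lemma lookup_expand_residue_numerators:
  assumes C: "C \<subseteq> W" and h: "h \<in> W" and p: "p \<in> residue_numerators C h"
  shows "lookup (expand \<sigma> p) e \<in> residue_numerators C h"
proof -
  obtain \<eta> where \<eta>: "\<eta> \<in> log_numerators C" "\<And>i. lin_pol h dvd \<eta> i - p * const_pol (h $ i)"
    using p by (rule residue_numeratorsE) blast
  show ?thesis
  proof (rule residue_numeratorsI)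
    show "(\<lambda>i. lookup (expand \<sigma> (\<eta> i)) e) \<in> log_numerators C"
      unfolding log_numerators_def
    proof (intro CollectI ballI allI)
      fix c i j assume c: "c \<in> C"
      then have "lin_pol c dvd \<eta> i * const_pol (c $ j) - \<eta> j * const_pol (c $ i)"
        using \<eta>(1) by (simp add: log_numerators_def)
      from dvd_lookup_expand[OF _ this] c C show "lin_pol c dvd lookup (expand \<sigma> (\<eta> i)) e * const_pol (c $ j)
          - lookup (expand \<sigma> (\<eta> j)) e * const_pol (c $ i)"
        by (auto simp: unital_hom_minus[OF unital_hom_expand] lookup_minus lookup_expand_mult_const)
    qed
    show "lin_pol h dvd lookup (expand \<sigma> (\<eta> i)) e - lookup (expand \<sigma> p) e * const_pol (h $ i)" for i
      using dvd_lookup_expand[OF h \<eta>(2), of i e]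
      by (simp add: unital_hom_minus[OF unital_hom_expand] lookup_minus lookup_expand_mult_const)
  qed
qed

end

text \<open>
  The ideal is homogeneous for the grading of \<open>expand\<close>, and the lowest piece of a polynomial outside
  the ideal of \<open>W\<close> is a nonzero constant.
\<close>

lemma residue_numerators_saturated:
  fixes W :: "('k::field ^ 'n::{finite,linorder}) set"
  assumes W: "vec.subspace W" and C: "C \<subseteq> W" and h: "h \<in> W"
    and a: "a \<notin> lin_ideal W" and ap: "a * p \<in> residue_numerators C h"
  shows "p \<in> residue_numerators C h"
proof -
  let ?N = "residue_numerators C h"
  obtain \<sigma> where \<sigma>: "Vector_Spaces.linear (*s) (*s) \<sigma>"
    "\<And>c. pol_eval const_pol (\<lambda>i. lin_pol (\<sigma> (axis i 1))) (lin_pol c) = lin_pol (\<sigma> c)"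
    "\<And>p. p \<in> lin_ideal W \<longleftrightarrow> pol_eval const_pol (\<lambda>i. lin_pol (\<sigma> (axis i 1))) p = 0"
    and ker: "\<And>c. \<sigma> c = 0 \<longleftrightarrow> c \<in> W" and "\<And>c. c - \<sigma> c \<in> W"
    by (rule lin_ideal_kernel[OF W]) (rule that)
  define \<pi> where "\<pi> = pol_eval const_pol (\<lambda>i. lin_pol (\<sigma> (axis i 1)))"
  have hom: "unital_hom \<pi>" unfolding \<pi>_def by (intro unital_hom_pol_eval unital_hom_const_pol)
  let ?t = "Poly_Mapping.single (Poly_Mapping.single None 1) 1 :: ('n option \<Rightarrow>\<^sub>0 nat) \<Rightarrow>\<^sub>0 ('n, 'k) pol"
  \<comment> \<open>Setting the variable \<open>None\<close> to 0 in \<open>expand \<sigma>\<close>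
    leaves only the image of the projection, which is \<open>expand0\<close> after
    \<open>\<pi>\<close>.\<close>
  have "?t dvd expand \<sigma> a - expand0 (\<pi> a)"
  proof -
    let ?Y = "\<lambda>i. (\<Sum>j\<in>UNIV. Poly_Mapping.single (Poly_Mapping.single (Some j) 1) (const_pol (\<sigma> (axis i 1) $ j)))"
    have "expand0 (\<pi> a) = pol_eval (\<lambda>a. Poly_Mapping.single 0 (const_pol a)) ?Y a"
    proof (rule unital_hom_pol_cong[of "\<lambda>a. expand0 (\<pi> a)"])
      show "unital_hom (\<lambda>a. expand0 (\<pi> a))" by (rule unital_hom_comp[OF unital_hom_expand0 hom])
    qed (simp_all add: expand0_def \<pi>_def unital_hom_pol_eval unital_hom_single_const unital_hom_const_pol
        pol_eval_const pol_eval_var pol_eval_lin mult_single)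
    moreover have "expand \<sigma> a - pol_eval (\<lambda>a. Poly_Mapping.single 0 (const_pol a)) ?Y a \<in> {b. ?t dvd b}"
      unfolding expand_def
    proof (rule pol_eval_diff_in_ideal[OF unital_hom_single_const is_ideal_multiples])
      fix i
      have "Poly_Mapping.single (Poly_Mapping.single None 1 + 0) (1 * lin_pol (axis i 1 - \<sigma> (axis i 1)))
          = ?t * Poly_Mapping.single 0 (lin_pol (axis i 1 - \<sigma> (axis i 1)))"
        by (simp only: mult_single)
      then show "Poly_Mapping.single (Poly_Mapping.single None 1) (lin_pol (axis i 1 - \<sigma> (axis i 1))) + ?Y i - ?Y i \<in> {b. ?t dvd b}"
        by simp
    qed
    ultimately show ?thesis by simp
  qed
  then obtain Q where Q: "expand \<sigma> a - expand0 (\<pi> a) = ?t * Q" by (rule dvdE)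
  have low: "lookup (expand \<sigma> a) e = lookup (expand0 (\<pi> a)) e" if "lookup e None = 0" for e
  proof -
    have "lookup (expand \<sigma> a - expand0 (\<pi> a)) e = 0"
      unfolding Q by (rule lookup_single_mult_None[OF that])
    then show ?thesis by (simp add: lookup_minus)
  qed
  \<comment> \<open>Outside the ideal of \<open>W\<close> the projection of \<open>a\<close> is
    nonzero, and \<open>expand0\<close> is injective because \<open>collapse\<close> inverts
    it.\<close>
  have "expand0 (\<pi> a) \<noteq> 0"
  proof
    assume "expand0 (\<pi> a) = 0"
    then have "collapse (expand0 (\<pi> a)) = 0"
      by (simp only: unital_hom_zero[OF unital_hom_collapse])
    then show False
      using a \<sigma>(3)[of a] by (simp add: collapse_expand0 \<pi>_def)
  qed
  then obtain e where "e \<in> keys (expand0 (\<pi> a))"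
    by (metis ex_in_conv keys_eq_empty)
  then have e: "lookup (expand0 (\<pi> a)) e \<noteq> 0"
    by (rule in_keys_iff[THEN iffD1])
  then have e0: "lookup e None = 0" using lookup_expand0(2)[of e "\<pi> a"] by blast
  define m where "m = Min (keys (expand \<sigma> a))"
  have ek: "e \<in> keys (expand \<sigma> a)" unfolding in_keys_iff low[OF e0] by (rule e)
  then have "Min (keys (expand \<sigma> a)) \<in> keys (expand \<sigma> a)"
    by (intro Min_in) auto
  then have m: "m \<in> keys (expand \<sigma> a)" "\<And>d. d \<in> keys (expand \<sigma> a) \<Longrightarrow> m \<le> d"
    by (auto simp only: m_def intro: Min_le[OF finite_keys])
  \<comment> \<open>The monomial \<open>e\<close> has exponent 0 at \<open>None\<close>, so the
    lowest one does too, and its coefficient is one of \<open>expand0 (\<pi> a)\<close>, a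
    constant.\<close>
  have m0: "lookup m None = 0"
    using lookup_None_mono[OF m(2)[OF ek]] e0 by simp
  obtain k where k: "lookup (expand \<sigma> a) m = const_pol k"
    using lookup_expand0(1)[of "\<pi> a" m] unfolding low[OF m0] by blast
  have "lookup (expand \<sigma> a) m \<noteq> 0"
    using m(1) by (rule in_keys_iff[THEN iffD1])
  then have "k \<noteq> 0" unfolding k by (auto simp: unital_hom_zero[OF unital_hom_const_pol])
  have "const_pol k * const_pol (1 / k) = (const_pol (k * (1 / k)) :: ('n, 'k) pol)"
    by (simp only: unital_hom_mult[OF unital_hom_const_pol])
  also have "\<dots> = 1"
    using \<open>k \<noteq> 0\<close> by (simp add: unital_hom_one[OF unital_hom_const_pol])
  finally have unit: "lookup (expand \<sigma> a) m dvd 1"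
    unfolding k by (intro dvdI[of _ _ "const_pol (1 / k)"]) (rule sym)
  have "lookup (expand \<sigma> p) d \<in> ?N" for d
  proof (rule coeffs_in_ideal_if_lowest_unit[OF is_ideal_residue_numerators m(2) unit])
    show "lookup (expand \<sigma> a * expand \<sigma> p) d \<in> ?N" for d
      using lookup_expand_residue_numerators[OF \<sigma>(1) ker C h ap]
      by (simp add: unital_hom_mult[OF unital_hom_expand])
  qed
  then show ?thesis
    using collapse_in_ideal[OF is_ideal_residue_numerators, of "expand \<sigma> p"] by (simp add: collapse_expand)
qed

section \<open>Powers and products modulo ideals\<close>

text \<open>Multiplying the relations modulo \<open>T\<close> puts a product of powers of
  \<open>a\<close> into the ideal of the product. Geometrically, the zero set of a product is the
  union of those of its factors.\<close>

lemma power_in_ideal_span_insert_prod: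
  fixes a :: "'a::comm_ring_1"
  assumes "finite D" "\<And>L. L \<in> D \<Longrightarrow> \<exists>k. a ^ k \<in> ideal_span (insert (g L) T)"
  shows "\<exists>k. a ^ k \<in> ideal_span (insert (\<Prod>L\<in>D. g L) T)"
  using assms
proof (induction D)
  case empty
  have "a ^ 0 \<in> ideal_span (insert (\<Prod>L\<in>{}. g L) T)"
    by (simp add: ring_mod.span_base)
  then show ?case by blast
next
  case (insert L D)
  let ?G = "\<Prod>L\<in>D. g L"
  obtain k l where "a ^ k \<in> ideal_span (insert (g L) T)" "a ^ l \<in> ideal_span (insert ?G T)"
    using insert by blast
  then obtain r s where r: "a ^ k - r * g L \<in> ideal_span T" and s: "a ^ l - s * ?G \<in> ideal_span T"
    by (auto simp: ring_mod.span_insert)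
  have "a ^ (k + l) - (r * s) * (g L * ?G) = a ^ k * (a ^ l - s * ?G) + (s * ?G) * (a ^ k - r * g L)"
    by (simp add: power_add algebra_simps)
  also have "\<dots> \<in> ideal_span T"
    by (intro ring_mod.span_add ring_mod.span_scale r s)
  finally have "a ^ (k + l) \<in> ideal_span (insert (\<Prod>L\<in>insert L D. g L) T)"
    unfolding ring_mod.span_insert using insert.hyps by auto
  then show ?case by blast
qed

text \<open>Replaces the choice of a maximal annihilator in a Noetherian ring: the elements
  \<open>g L\<close> are treated in turn, each time multiplying by the last power that does not yet
  kill.\<close>

lemma ex_multiple_killed:
  fixes m :: "'a::comm_ring_1"
  assumes J: "is_ideal J" and "finite D" "m \<notin> J" "\<And>L. L \<in> D \<Longrightarrow> \<exists>k. g L ^ k * m \<in> J"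
  shows "\<exists>s. s * m \<notin> J \<and> (\<forall>L\<in>D. g L * (s * m) \<in> J)"
  using assms(2,4)
proof (induction D)
  case empty
  then show ?case using \<open>m \<notin> J\<close> by (intro exI[of _ 1]) simp
next
  case (insert L D)
  then obtain s where s: "s * m \<notin> J" "\<And>M. M \<in> D \<Longrightarrow> g M * (s * m) \<in> J" by auto
  obtain k where "g L ^ k * m \<in> J" using insert.prems by blast
  then have k: "g L ^ k * (s * m) \<in> J"
    using ring_mod.subspace_scale[OF J, of "g L ^ k * m" s] by (simp add: mult_ac)
  \<comment> \<open>\<open>n\<close> is positive because \<open>s * m\<close> is not in
    \<open>J\<close>; its predecessor gives the new factor.\<close>
  define n where "n = (LEAST n. g L ^ n * (s * m) \<in> J)"
  have n: "g L ^ n * (s * m) \<in> J"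
    unfolding n_def by (rule LeastI[of "\<lambda>n. g L ^ n * (s * m) \<in> J", OF k])
  with s(1) obtain l where l: "n = Suc l" by (cases n) auto
  have "g L ^ l * (s * m) \<notin> J"
    using not_less_Least[of l "\<lambda>n. g L ^ n * (s * m) \<in> J"] l by (simp add: n_def)
  moreover have "g L * (g L ^ l * s * m) \<in> J"
    using n by (simp add: l mult_ac)
  moreover have "g M * (g L ^ l * s * m) \<in> J" if "M \<in> D" for M
    using ring_mod.subspace_scale[OF J s(2)[OF that], of "g L ^ l"] by (simp add: mult_ac)
  ultimately show ?case
    by (intro exI[of _ "g L ^ l * s"]) (auto simp: mult_ac)
qed

section \<open>Flats and residue ideals\<close>

lemma restriction_mono: "B \<subseteq> C \<Longrightarrow> restriction B H \<subseteq> restriction C H"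
  by (auto simp: restriction_def)

lemma finite_restriction: "finite B \<Longrightarrow> finite (restriction B H)"
  by (simp add: restriction_def setcompr_eq_image)

lemma finite_restriction_flats: "finite B \<Longrightarrow> finite (restriction_flats B H)"
proof -
  have "restriction_flats B H = (\<lambda>C. H \<inter> \<Inter>C) ` Pow (restriction B H)"
    by (auto simp: restriction_flats_def)
  then show "finite B \<Longrightarrow> ?thesis" by (simp add: finite_restriction)
qed

lemma Inter_in_restriction_flats:
  assumes "H \<in> C" "C \<subseteq> B"
  shows "\<Inter>C \<in> restriction_flats B H"
proof -
  have "(\<lambda>L. H \<inter> L) ` (C - {H}) \<subseteq> restriction B H"
    using assms(2) by (auto simp: restriction_def)
  moreover have "\<Inter>C = H \<inter> \<Inter>((\<lambda>L. H \<inter> L) ` (C - {H}))"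
    using assms(1) by auto
  ultimately show ?thesis unfolding restriction_flats_def by blast
qed

lemma restriction_flats_subset: "X \<in> restriction_flats B H \<Longrightarrow> X \<subseteq> H"
  by (auto simp: restriction_flats_def)

text \<open>Each restricted hyperplane in a presentation of \<open>X\<close> is
  \<open>H \<inter> L\<close> for some \<open>L\<close> containing \<open>X\<close>, so the
  intersection of all such \<open>L\<close> and \<open>H\<close> is no larger than
  \<open>X\<close>.\<close>

lemma restriction_flat_eq_Inter:
  assumes "X \<in> restriction_flats B H" "H \<in> B"
  shows "X = \<Inter>(localization B X)"
proof -
  obtain C where C: "C \<subseteq> restriction B H" "X = H \<inter> \<Inter>C"
    using assms(1) by (auto simp: restriction_flats_def)
  have "v \<in> X" if v: "v \<in> \<Inter>(localization B X)" for v
  proof -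
    have "v \<in> H" using v assms(2) C(2) by (auto simp: localization_def)
    moreover have "v \<in> Y" if "Y \<in> C" for Y
    proof -
      have "Y \<in> restriction B H" using that C(1) by blast
      then obtain L where "L \<in> B" "Y = H \<inter> L" by (auto simp: restriction_def)
      moreover from this have "X \<subseteq> L" using that C(2) by blast
      ultimately show ?thesis using v \<open>v \<in> H\<close> by (auto simp: localization_def)
    qed
    ultimately show ?thesis using C(2) by blast
  qed
  then show ?thesis by (auto simp: localization_def)
qed

lemma localization_localization: "X \<subseteq> Y \<Longrightarrow> localization (localization B X) Y = localization B Y"
  by (auto simp: localization_def)

lemma localization_subset: "localization B X \<subseteq> B"
  by (auto simp: localization_def)

locale arrangement_with_hyperplane =
  fixes scl :: "'k::field \<Rightarrow> 'v::ab_group_add \<Rightarrow> 'v"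
    and x :: "'n::{finite,linorder} \<Rightarrow> 'v \<Rightarrow> 'k"
    and A :: "'v set set" and H :: "'v set"
    and \<alpha> \<beta> :: "'v set \<Rightarrow> 'k ^ 'n::{finite,linorder}"
  assumes vs: "vector_space scl"
    and dual: "dual_basis scl x"
    and arr: "arrangement scl A"
    and HA: "H \<in> A"
    and forms: "defining_forms x UNIV A \<alpha>"
    and restricted_forms: "defining_forms x H (restriction A H) \<beta>"
begin

text \<open>The preimage of the residue ideal of \<open>B\<close> in the polynomial ring; see \<open>residue_ideal_eq\<close>.\<close>

definition lifted_ideal :: "'v set set \<Rightarrow> ('n, 'k) pol set" where
  "lifted_ideal B = {r. defining_poly \<beta> (restriction B H) * r \<in> residue_numerators (\<alpha> ` B) (\<alpha> H)}"

text \<open>The preimage of the prime P_X when \<open>X\<close> lies in \<open>H\<close>; see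
  \<open>subspace_ideal_eq\<close>.\<close>

definition flat_ideal :: "'v set \<Rightarrow> ('n, 'k) pol set" where
  "flat_ideal X = lin_ideal (annihilator x X)"

text \<open>The defining polynomial of the hyperplanes lost in the localization.\<close>

definition cofactor :: "'v set set \<Rightarrow> 'v set \<Rightarrow> ('n, 'k) pol" where
  "cofactor B X = (\<Prod>L\<in>{L \<in> B. \<not> X \<subseteq> L}. lin_pol (\<alpha> L))"

lemma finite_A: "finite A"
  using arr by (simp add: arrangement_def)

lemma hyperplane_eq: "L \<in> A \<Longrightarrow> L = {v. lin_form x (\<alpha> L) v = 0}"
  using forms by (simp add: defining_forms_def)

lemma restricted_hyperplane_eq: "Y \<in> restriction A H \<Longrightarrow> Y = {v \<in> H. lin_form x (\<beta> Y) v = 0}"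
  using restricted_forms by (simp add: defining_forms_def)

lemma form_in_annihilator_iff: "L \<in> A \<Longrightarrow> \<alpha> L \<in> annihilator x X \<longleftrightarrow> X \<subseteq> L"
  using hyperplane_eq[of L] by (auto simp: annihilator_def)

lemma restricted_form_in_annihilator_iff:
  "Y \<in> restriction A H \<Longrightarrow> X \<subseteq> H \<Longrightarrow> \<beta> Y \<in> annihilator x X \<longleftrightarrow> X \<subseteq> Y"
  using restricted_hyperplane_eq[of Y] by (auto simp: annihilator_def)

lemma is_ideal_flat_ideal [simp]: "is_ideal (flat_ideal X)"
  by (simp add: flat_ideal_def)

lemma flat_ideal_prime: "a * b \<in> flat_ideal X \<Longrightarrow> a \<in> flat_ideal X \<or> b \<in> flat_ideal X"
  unfolding flat_ideal_def by (rule lin_ideal_prime[OF subspace_annihilator])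

lemma one_notin_flat_ideal: "1 \<notin> flat_ideal X"
  unfolding flat_ideal_def by (rule one_notin_lin_ideal[OF subspace_annihilator])

lemma lin_pol_in_flat_ideal: "lin_pol c \<in> flat_ideal X \<longleftrightarrow> c \<in> annihilator x X"
  unfolding flat_ideal_def by (rule lin_pol_in_lin_ideal[OF subspace_annihilator])

lemma flat_ideal_antimono: "X \<subseteq> Y \<Longrightarrow> flat_ideal Y \<subseteq> flat_ideal X"
  unfolding flat_ideal_def by (intro lin_ideal_mono annihilator_antimono)

text \<open>By the double annihilator, the forms vanishing on an intersection are spanned by those
  of its hyperplanes.\<close>

lemma flat_ideal_Inter:
  assumes "C \<subseteq> A"
  shows "flat_ideal (\<Inter>C) = lin_ideal (\<alpha> ` C)"
proof -
  have "\<Inter>C = {v. \<forall>c\<in>\<alpha> ` C. lin_form x c v = 0}"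
    using hyperplane_eq assms by blast
  then show ?thesis
    unfolding flat_ideal_def by (simp only: annihilator_common_zeros[OF vs dual] lin_ideal_span)
qed

lemma cofactor_notin_flat_ideal: "B \<subseteq> A \<Longrightarrow> cofactor B X \<notin> flat_ideal X"
proof
  assume B: "B \<subseteq> A" and "cofactor B X \<in> flat_ideal X"
  then have "\<exists>L\<in>{L \<in> B. \<not> X \<subseteq> L}. lin_pol (\<alpha> L) \<in> flat_ideal X"
    unfolding cofactor_def flat_ideal_def
    by (intro lin_ideal_prod[OF subspace_annihilator]) (auto intro: finite_subset[OF _ finite_A])
  then show False
    using B by (auto simp: lin_pol_in_flat_ideal form_in_annihilator_iff subset_iff)
qed

section \<open>Residue ideals of an arrangement and of its localizations\<close>

lemma is_ideal_lifted_ideal [simp]: "is_ideal (lifted_ideal B)"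
proof -
  note I = is_ideal_residue_numerators[of "\<alpha> ` B" "\<alpha> H"]
  show ?thesis
    unfolding ring_mod.subspace_def lifted_ideal_def
    using ring_mod.subspace_0[OF I] ring_mod.subspace_add[OF I] ring_mod.subspace_scale[OF I]
    by (simp add: distrib_left mult.left_commute)
qed

lemma form_in_lifted_ideal: "lin_pol (\<alpha> H) \<in> lifted_ideal B"
  unfolding lifted_ideal_def
  using ring_mod.subspace_scale[OF is_ideal_residue_numerators lin_pol_in_residue_numerators] by blast

lemma lifted_ideal_saturated:
  assumes "X \<subseteq> H" "B \<subseteq> A" "a \<notin> flat_ideal X" "a * r \<in> lifted_ideal (localization B X)"
  shows "r \<in> lifted_ideal (localization B X)"
proof -
  let ?Q = "defining_poly \<beta> (restriction (localization B X) H)"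
  have "?Q * r \<in> residue_numerators (\<alpha> ` localization B X) (\<alpha> H)"
  proof (rule residue_numerators_saturated[OF subspace_annihilator[of x X]])
    show "\<alpha> ` localization B X \<subseteq> annihilator x X"
      using assms(2) by (auto simp: localization_def form_in_annihilator_iff)
    show "\<alpha> H \<in> annihilator x X" using assms(1) HA by (simp add: form_in_annihilator_iff)
    show "a \<notin> lin_ideal (annihilator x X)" using assms(3) by (simp add: flat_ideal_def)
    show "a * (?Q * r) \<in> residue_numerators (\<alpha> ` localization B X) (\<alpha> H)"
      using assms(4) by (simp add: lifted_ideal_def mult.left_commute)
  qed
  then show ?thesis by (simp add: lifted_ideal_def)
qed

lemma defining_poly_split:
  assumes "B \<subseteq> A"
  shows "defining_poly \<beta> (restriction B H)
    = defining_poly \<beta> (restriction B H - restriction (localization B X) H)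
      * defining_poly \<beta> (restriction (localization B X) H)"
proof -
  have "finite (restriction B H)"
    using assms finite_A by (auto intro: finite_restriction finite_subset)
  then show ?thesis
    unfolding defining_poly_def
    by (intro prod.subset_diff restriction_mono localization_subset)
qed

text \<open>The cofactor makes the numerator form logarithmic along the missing hyperplanes; the
  first factor in \<open>defining_poly_split\<close> adapts the denominator.\<close>

lemma cofactor_mult_lifted_ideal:
  assumes B: "B \<subseteq> A" and r: "r \<in> lifted_ideal (localization B X)"
  shows "cofactor B X * r \<in> lifted_ideal B"
proof -
  let ?Q = "defining_poly \<beta> (restriction B H)"
    and ?Q0 = "defining_poly \<beta> (restriction B H - restriction (localization B X) H)"
    and ?Q1 = "defining_poly \<beta> (restriction (localization B X) H)"
  have fin: "finite {L \<in> B. \<not> X \<subseteq> L}"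
    using B finite_A by (auto intro: finite_subset)
  have "?Q1 * r \<in> residue_numerators (\<alpha> ` localization B X) (\<alpha> H)"
    using r by (simp add: lifted_ideal_def)
  then have "cofactor B X * (?Q1 * r) \<in> residue_numerators (\<alpha> ` localization B X \<union> \<alpha> ` {L \<in> B. \<not> X \<subseteq> L}) (\<alpha> H)"
    by (rule residue_numerators_mult_forms[rotated]) (use fin in \<open>auto simp: cofactor_def intro!: dvd_prodI\<close>)
  moreover have "\<alpha> ` localization B X \<union> \<alpha> ` {L \<in> B. \<not> X \<subseteq> L} = \<alpha> ` B"
    by (auto simp: localization_def)
  ultimately have "?Q0 * (cofactor B X * (?Q1 * r)) \<in> residue_numerators (\<alpha> ` B) (\<alpha> H)"
    by (simp add: ring_mod.subspace_scale[OF is_ideal_residue_numerators])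
  then show ?thesis
    unfolding lifted_ideal_def defining_poly_split[OF B, of X] by (simp add: mult_ac)
qed

text \<open>A numerator form for \<open>B\<close> is also one for the localization, but its residue
  there gains the forms of the restricted hyperplanes not coming from the localization. Their
  product lies outside the prime of \<open>X\<close> and is cancelled by saturation.\<close>

lemma lifted_ideal_localization_superset:
  assumes B: "B \<subseteq> A" and X: "X \<subseteq> H"
  shows "lifted_ideal B \<subseteq> lifted_ideal (localization B X)"
proof
  fix r assume r: "r \<in> lifted_ideal B"
  let ?D = "restriction B H - restriction (localization B X) H"
  have "finite ?D"
    using assms finite_A by (auto intro: finite_restriction finite_subset)
  have "defining_poly \<beta> ?D \<notin> flat_ideal X"
  proof
    assume "defining_poly \<beta> ?D \<in> flat_ideal X"
    then obtain Y where Y: "Y \<in> ?D" "lin_pol (\<beta> Y) \<in> flat_ideal X"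
      using lin_ideal_prod[OF subspace_annihilator \<open>finite ?D\<close>] unfolding flat_ideal_def defining_poly_def by blast
    have "Y \<in> restriction A H" using Y(1) restriction_mono[OF B] by blast
    then have "X \<subseteq> Y"
      using Y(2) X by (simp add: lin_pol_in_flat_ideal restricted_form_in_annihilator_iff)
    with Y(1) show False by (auto simp: restriction_def localization_def)
  qed
  moreover have "defining_poly \<beta> ?D * r \<in> lifted_ideal (localization B X)"
  proof -
    have "\<alpha> ` localization B X \<subseteq> \<alpha> ` B" using localization_subset by blast
    then show ?thesis
      using r residue_numerators_antimono[of "\<alpha> ` localization B X" "\<alpha> ` B" "\<alpha> H"]
      unfolding lifted_ideal_def defining_poly_split[OF B, of X] by (auto simp: mult_ac)
  qed
  ultimately show "r \<in> lifted_ideal (localization B X)"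
    using lifted_ideal_saturated[OF X B] by blast
qed

text \<open>
  Going down from large to small intersections \<open>X\<close> of hyperplanes, one finds a power of \<open>a\<close> in
  \<open>I + flat_ideal X\<close>; the last of them is \<open>H\<close>.
\<close>

lemma power_in_ideal_if_locally:
  assumes B: "B \<subseteq> A" "H \<in> B" and I: "is_ideal I" "lin_pol (\<alpha> H) \<in> I"
    and local: "\<And>X. X \<in> restriction_flats B H \<Longrightarrow> a \<in> flat_ideal X \<or> cofactor B X \<in> I"
  shows "\<exists>k. a ^ k \<in> I"
proof -
  have finB: "finite B" using B(1) finite_A by (rule finite_subset)
  \<comment> \<open>\<open>C\<close> collects the hyperplanes whose forms have been adjoined to
    \<open>I\<close>. The case of \<open>C\<close> uses the cases with one more hyperplane.\<close>
  have "\<exists>k. a ^ k \<in> ideal_span (I \<union> (\<lambda>L. lin_pol (\<alpha> L)) ` C)" if "C \<subseteq> B" "H \<in> C" for C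
    using that
  proof (induction "card (B - C)" arbitrary: C rule: less_induct)
    case less
    let ?T = "I \<union> (\<lambda>L. lin_pol (\<alpha> L)) ` C"
    have flat: "\<Inter>C \<in> restriction_flats B H"
      using less.prems by (intro Inter_in_restriction_flats)
    show ?case
    proof (cases "a \<in> flat_ideal (\<Inter>C)")
      case True
      then have "a \<in> ideal_span ((\<lambda>L. lin_pol (\<alpha> L)) ` C)"
        using flat_ideal_Inter[of C] less.prems B(1) by (simp add: lin_ideal_def image_image)
      then have "a ^ 1 \<in> ideal_span ?T"
        using ring_mod.span_mono[of "(\<lambda>L. lin_pol (\<alpha> L)) ` C" ?T] by auto
      then show ?thesis by blast
    next
      case False
      let ?D = "{L \<in> B. \<not> \<Inter>C \<subseteq> L}"
      have "\<exists>k. a ^ k \<in> ideal_span (insert (lin_pol (\<alpha> L)) ?T)" if L: "L \<in> ?D" for L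
      proof -
        have "L \<notin> C" using L by auto
        then have "card (B - insert L C) < card (B - C)"
          using L finB by (intro psubset_card_mono) auto
        then have "\<exists>k. a ^ k \<in> ideal_span (I \<union> (\<lambda>L. lin_pol (\<alpha> L)) ` insert L C)"
          using less L by blast
        then show ?thesis by simp
      qed
      \<comment> \<open>A power of \<open>a\<close> is reached after adjoining any one factor of the
        cofactor, hence after adjoining the cofactor, which already belongs to
        \<open>I\<close>.\<close>
      then have "\<exists>k. a ^ k \<in> ideal_span (insert (cofactor B (\<Inter>C)) ?T)"
        unfolding cofactor_def using finB by (intro power_in_ideal_span_insert_prod) auto
      moreover have "insert (cofactor B (\<Inter>C)) ?T = ?T"
        using local[OF flat] False by auto
      ultimately show ?thesis by simp
    qed
  qed
  \<comment> \<open>The form of \<open>H\<close> is in \<open>I\<close>, so the starting set adjoins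
    nothing.\<close>
  from this[of "{H}"] obtain k where "a ^ k \<in> ideal_span (insert (lin_pol (\<alpha> H)) I)"
    using B(2) by auto
  moreover have "insert (lin_pol (\<alpha> H)) I = I" using I(2) by blast
  moreover have "ideal_span I = I" using I(1) by (simp only: ring_mod.span_eq_iff)
  ultimately show ?thesis by auto
qed

section \<open>Radical, associated primes and primary components in the polynomial ring\<close>

definition proper_flats :: "'v set set" where
  "proper_flats = {X \<in> restriction_flats A H. 1 \<notin> lifted_ideal (localization A X)}"

text \<open>An element outside the prime of \<open>X\<close> would bring 1 into the ideal by
  saturation.\<close>

lemma lifted_ideal_subset_flat_ideal:
  assumes "X \<subseteq> H" "1 \<notin> lifted_ideal (localization A X)"
  shows "lifted_ideal (localization A X) \<subseteq> flat_ideal X"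
  using lifted_ideal_saturated[OF assms(1) order.refl, of _ 1] assms(2) by auto

lemma cofactor_in_lifted_ideal:
  assumes "B \<subseteq> A" "1 \<in> lifted_ideal (localization B X)"
  shows "cofactor B X \<in> lifted_ideal B"
  using cofactor_mult_lifted_ideal[OF assms] by simp

text \<open>For a flat that is not proper, 1 is in the local ideal and so the cofactor is in the
  global one. Hence every flat meets one of the alternatives of
  \<open>power_in_ideal_if_locally\<close>.\<close>

lemma power_in_lifted_ideal_iff:
  "(\<exists>k. a ^ k \<in> lifted_ideal A) \<longleftrightarrow> (\<forall>X\<in>proper_flats. a \<in> flat_ideal X)"
proof
  assume "\<exists>k. a ^ k \<in> lifted_ideal A"
  then obtain k where k: "a ^ k \<in> lifted_ideal A" by blast
  show "\<forall>X\<in>proper_flats. a \<in> flat_ideal X"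
  proof
    fix X assume X: "X \<in> proper_flats"
    then have "X \<subseteq> H" by (auto simp: proper_flats_def restriction_flats_def)
    with X k have "a ^ k \<in> flat_ideal X"
      using lifted_ideal_localization_superset[of A X] lifted_ideal_subset_flat_ideal[of X]
      by (auto simp: proper_flats_def)
    then show "a \<in> flat_ideal X"
      by (induction k) (auto simp: one_notin_flat_ideal dest: flat_ideal_prime)
  qed
next
  assume *: "\<forall>X\<in>proper_flats. a \<in> flat_ideal X"
  show "\<exists>k. a ^ k \<in> lifted_ideal A"
  proof (rule power_in_ideal_if_locally[OF order.refl HA is_ideal_lifted_ideal form_in_lifted_ideal])
    fix X assume "X \<in> restriction_flats A H"
    then show "a \<in> flat_ideal X \<or> cofactor A X \<in> lifted_ideal A"
      using * cofactor_in_lifted_ideal[of A X] by (auto simp: proper_flats_def)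
  qed
qed

text \<open>\<open>X\<close> is the intersection of the hyperplanes whose forms lie in
  \<open>P\<close>. Its cofactor avoids \<open>P\<close> by primality, whereas an element of
  \<open>P\<close> outside the prime of \<open>X\<close> would put \<open>m\<close> in the local
  ideal, hence the cofactor in \<open>P\<close>.\<close>

lemma prime_colon_lifted_ideal:
  assumes P: "P = {p. p * m \<in> lifted_ideal A}"
    and prime: "\<And>a b. a * b \<in> P \<Longrightarrow> a \<in> P \<or> b \<in> P" and one: "1 \<notin> P"
  shows "\<exists>X\<in>proper_flats. P = flat_ideal X"
proof -
  have I: "is_ideal P"
    unfolding P ring_mod.subspace_def
    using ring_mod.subspace_0[OF is_ideal_lifted_ideal] ring_mod.subspace_add[OF is_ideal_lifted_ideal]
      ring_mod.subspace_scale[OF is_ideal_lifted_ideal]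
    by (auto simp: distrib_right mult.assoc)
  have sub: "lifted_ideal A \<subseteq> P"
    unfolding P using is_ideal_mult_right[OF is_ideal_lifted_ideal] by blast
  define C where "C = {L \<in> A. lin_pol (\<alpha> L) \<in> P}"
  define X where "X = \<Inter>C"
  have "H \<in> C" using HA sub form_in_lifted_ideal by (auto simp: C_def)
  then have flat: "X \<in> restriction_flats A H" and "X \<subseteq> H"
    unfolding X_def by (auto intro!: Inter_in_restriction_flats simp: C_def)
  have "C \<subseteq> A" by (auto simp: C_def)
  have "lin_ideal (\<alpha> ` C) \<subseteq> P"
    by (rule lin_ideal_minimal[OF I]) (auto simp: C_def)
  then have "flat_ideal X \<subseteq> P"
    unfolding X_def by (simp only: flat_ideal_Inter[OF \<open>C \<subseteq> A\<close>])
  have cof: "cofactor A X \<notin> P"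
  proof -
    have ex: "\<exists>L\<in>D. lin_pol (\<alpha> L) \<in> P" if "finite D" "(\<Prod>L\<in>D. lin_pol (\<alpha> L)) \<in> P" for D
      using that by (induction D) (auto simp: one dest: prime)
    have "\<exists>L\<in>{L \<in> A. \<not> X \<subseteq> L}. lin_pol (\<alpha> L) \<in> P" if "cofactor A X \<in> P"
      using ex[of "{L \<in> A. \<not> X \<subseteq> L}"] that finite_A unfolding cofactor_def by simp
    then show ?thesis by (auto simp: X_def C_def)
  qed
  have "P \<subseteq> flat_ideal X"
  proof (rule ccontr)
    assume "\<not> P \<subseteq> flat_ideal X"
    then obtain a where a: "a \<notin> flat_ideal X" "a * m \<in> lifted_ideal A" by (auto simp: P)
    then have "m \<in> lifted_ideal (localization A X)"
      using lifted_ideal_localization_superset[OF order.refl \<open>X \<subseteq> H\<close>]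
        lifted_ideal_saturated[OF \<open>X \<subseteq> H\<close> order.refl] by blast
    then show False using cofactor_mult_lifted_ideal[OF order.refl] cof by (auto simp: P)
  qed
  \<comment> \<open>Were \<open>X\<close> not proper, its cofactor would lie in the lifted ideal of
    \<open>A\<close>, hence in \<open>P\<close>.\<close>
  moreover have "X \<in> proper_flats"
    using flat cofactor_in_lifted_ideal[OF order.refl, of X] sub cof by (auto simp: proper_flats_def)
  ultimately show ?thesis using \<open>flat_ideal X \<subseteq> P\<close> by blast
qed

lemma ex_colon_lifted_ideal:
  assumes m: "m \<notin> lifted_ideal A"
  shows "\<exists>X\<in>restriction_flats A H. m \<notin> lifted_ideal (localization A X) \<and>
    (\<exists>s. {p. p * (s * m) \<in> lifted_ideal A} = flat_ideal X)"
proof -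
  define F where "F = {X \<in> restriction_flats A H. m \<notin> lifted_ideal (localization A X)}"
  have "finite F" unfolding F_def using finite_restriction_flats[OF finite_A] by simp
  moreover have "localization A (\<Inter>A) = A" by (auto simp: localization_def)
  \<comment> \<open>Localizing at the center of \<open>A\<close> loses nothing, so the center is a
    candidate.\<close>
  then have "\<Inter>A \<in> F" using m Inter_in_restriction_flats[OF HA order.refl] by (simp add: F_def)
  ultimately obtain X where X: "X \<in> F" "\<And>Y. Y \<in> F \<Longrightarrow> X \<subseteq> Y \<Longrightarrow> X = Y"
    using finite_has_maximal[of F] by blast
  then have flat: "X \<in> restriction_flats A H" and mX: "m \<notin> lifted_ideal (localization A X)"
    by (auto simp: F_def)
  have XH: "X \<subseteq> H" using flat by (rule restriction_flats_subset)
  define B where "B = localization A X"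
  have B: "B \<subseteq> A" "H \<in> B" using XH HA by (auto simp: B_def localization_def)
  have X_eq: "X = \<Inter>B" unfolding B_def by (rule restriction_flat_eq_Inter[OF flat HA])
  let ?I = "{p. p * m \<in> lifted_ideal B}"
  have I: "is_ideal ?I"
    unfolding ring_mod.subspace_def
    using ring_mod.subspace_0[OF is_ideal_lifted_ideal] ring_mod.subspace_add[OF is_ideal_lifted_ideal]
      ring_mod.subspace_scale[OF is_ideal_lifted_ideal]
    by (auto simp: distrib_right mult.assoc)
  have "\<exists>k. lin_pol (\<alpha> L) ^ k \<in> ?I" if L: "L \<in> B" for L
  proof (rule power_in_ideal_if_locally[OF B I])
    show "lin_pol (\<alpha> H) \<in> ?I"
      using is_ideal_mult_right[OF is_ideal_lifted_ideal form_in_lifted_ideal] by simp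
    fix Y assume Y: "Y \<in> restriction_flats B H"
    then have "X \<subseteq> Y"
      using restriction_flat_eq_Inter[OF Y B(2)] localization_subset[of B Y] X_eq by auto
    show "lin_pol (\<alpha> L) \<in> flat_ideal Y \<or> cofactor B Y \<in> ?I"
    proof (cases "Y = X")
      case True
      then have "lin_pol (\<alpha> L) \<in> flat_ideal Y"
        using L B(1) by (auto simp: lin_pol_in_flat_ideal form_in_annihilator_iff B_def localization_def)
      then show ?thesis ..
    next
      \<comment> \<open>By maximality a strictly larger flat is no candidate, so \<open>m\<close>
        lies in its local ideal and the cofactor multiplies it into that of
        \<open>B\<close>.\<close>
      case False
      have "Y \<in> restriction_flats A H"
        using Y restriction_mono[OF B(1)] by (auto simp: restriction_flats_def)
      then have "m \<in> lifted_ideal (localization B Y)"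
        using X(2)[of Y] False \<open>X \<subseteq> Y\<close> by (auto simp: F_def B_def localization_localization)
      then show ?thesis using cofactor_mult_lifted_ideal[OF B(1)] by simp
    qed
  qed
  then obtain s where s: "s * m \<notin> lifted_ideal B" "\<And>L. L \<in> B \<Longrightarrow> lin_pol (\<alpha> L) * (s * m) \<in> lifted_ideal B"
    using ex_multiple_killed[OF is_ideal_lifted_ideal finite_subset[OF B(1) finite_A], of m B "\<lambda>L. lin_pol (\<alpha> L)"] mX
    by (auto simp: B_def)
  have kill: "p * (s * m) \<in> lifted_ideal B" if "p \<in> flat_ideal X" for p
  proof -
    have "is_ideal {p. p * (s * m) \<in> lifted_ideal B}"
      unfolding ring_mod.subspace_def
      using ring_mod.subspace_0[OF is_ideal_lifted_ideal] ring_mod.subspace_add[OF is_ideal_lifted_ideal]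
        ring_mod.subspace_scale[OF is_ideal_lifted_ideal]
      by (auto simp: distrib_right mult.assoc)
    then have "lin_ideal (\<alpha> ` B) \<subseteq> {p. p * (s * m) \<in> lifted_ideal B}"
      using s(2) by (intro lin_ideal_minimal) auto
    then show ?thesis using that X_eq flat_ideal_Inter[OF B(1)] by auto
  qed
  \<comment> \<open>The cofactor carries the relation from the localization to \<open>A\<close>. As
    it lies outside the prime of \<open>X\<close>, it does not enlarge the colon ideal.\<close>
  have "{p. p * (cofactor A X * s * m) \<in> lifted_ideal A} = flat_ideal X"
  proof safe
    fix p assume p: "p * (cofactor A X * s * m) \<in> lifted_ideal A"
    show "p \<in> flat_ideal X"
    proof (rule ccontr)
      assume "p \<notin> flat_ideal X"
      then have "p * cofactor A X \<notin> flat_ideal X"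
        using cofactor_notin_flat_ideal[OF order.refl] flat_ideal_prime by blast
      moreover have "p * cofactor A X * (s * m) \<in> lifted_ideal B"
        using p lifted_ideal_localization_superset[OF order.refl XH] by (auto simp: B_def mult_ac)
      ultimately show False
        using lifted_ideal_saturated[OF XH order.refl] s(1) unfolding B_def by blast
    qed
  next
    fix p assume "p \<in> flat_ideal X"
    then have "cofactor A X * (p * (s * m)) \<in> lifted_ideal A"
      using kill by (intro cofactor_mult_lifted_ideal) (auto simp: B_def)
    then show "p * (cofactor A X * s * m) \<in> lifted_ideal A" by (simp add: mult_ac)
  qed
  then show ?thesis using flat mX by blast
qed

text \<open>By minimality the prime of a proper flat containing \<open>X\<close> equals that of
  \<open>X\<close>. So \<open>b\<close> lies in the primes of all proper flats of the localization,
  and the local criterion applies.\<close>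

lemma power_in_localized_ideal:
  assumes X: "X \<in> proper_flats" and b: "b \<in> flat_ideal X"
    and minimal: "\<And>Y. lifted_ideal A \<subseteq> flat_ideal Y \<Longrightarrow> flat_ideal Y \<subseteq> flat_ideal X \<Longrightarrow> flat_ideal Y = flat_ideal X"
  shows "\<exists>k. b ^ k \<in> lifted_ideal (localization A X)"
proof -
  have flat: "X \<in> restriction_flats A H" using X by (simp add: proper_flats_def)
  have XH: "X \<subseteq> H" using flat by (rule restriction_flats_subset)
  define B where "B = localization A X"
  have B: "B \<subseteq> A" "H \<in> B" using XH HA by (auto simp: B_def localization_def)
  have "\<exists>k. b ^ k \<in> lifted_ideal B"
  proof (rule power_in_ideal_if_locally[OF B is_ideal_lifted_ideal form_in_lifted_ideal])
    fix Y assume Y: "Y \<in> restriction_flats B H"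
    have "X \<subseteq> Y"
      using restriction_flat_eq_Inter[OF Y B(2)] restriction_flat_eq_Inter[OF flat HA] localization_subset[of B Y]
      unfolding B_def by auto
    have YH: "Y \<subseteq> H" using Y by (rule restriction_flats_subset)
    show "b \<in> flat_ideal Y \<or> cofactor B Y \<in> lifted_ideal B"
    proof (cases "1 \<in> lifted_ideal (localization A Y)")
      case True
      then have "1 \<in> lifted_ideal (localization B Y)"
        using \<open>X \<subseteq> Y\<close> by (simp add: B_def localization_localization)
      then show ?thesis using cofactor_in_lifted_ideal[OF B(1)] by simp
    next
      case False
      then have "lifted_ideal A \<subseteq> flat_ideal Y"
        using lifted_ideal_localization_superset[OF order.refl YH] lifted_ideal_subset_flat_ideal[OF YH] by blast
      then show ?thesis using minimal[of Y] flat_ideal_antimono[OF \<open>X \<subseteq> Y\<close>] b by blast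
    qed
  qed
  then show ?thesis by (simp add: B_def)
qed

end

section \<open>The coordinate ring of the hyperplane\<close>

lemma pol_ring_simps [simp]:
  "carrier (ring_of_type_algebra :: 'a::comm_ring_1 ring) = UNIV"
  "p \<otimes>\<^bsub>ring_of_type_algebra\<^esub> q = p * q"
  "p \<oplus>\<^bsub>ring_of_type_algebra\<^esub> q = p + q"
  "\<one>\<^bsub>ring_of_type_algebra\<^esub> = (1 :: 'a)"
  "\<zero>\<^bsub>ring_of_type_algebra\<^esub> = (0 :: 'a)"
  by (simp_all add: ring_of_type_algebra_def)

lemma cring_pol_ring: "cring (ring_of_type_algebra :: 'a::comm_ring_1 ring)"
  by (rule cring_from_type_algebra)

lemma PIdl_pol_ring: "PIdl\<^bsub>ring_of_type_algebra\<^esub> a = {p. (a :: 'a::comm_ring_1) dvd p}"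
  by (auto simp: cgenideal_def dvd_def mult.commute)

context
  fixes a :: "'k::field ^ 'n::finite"
begin

lemma ideal_PIdl_lin_pol: "ideal (PIdl\<^bsub>pol_ring\<^esub> (lin_pol a)) pol_ring"
  by (rule cring.cgenideal_ideal[OF cring_pol_ring]) simp

lemma to_coord_ring_eq: "to_coord_ring a p = {q. lin_pol a dvd q - p}"
proof -
  have "(\<exists>h. lin_pol a dvd h \<and> q = h + p) \<longleftrightarrow> lin_pol a dvd q - p" for q
    by (metis add_diff_cancel diff_add_cancel)
  then show ?thesis
    by (auto simp: to_coord_ring_def a_r_coset_def' PIdl_pol_ring)
qed

lemma to_coord_ring_eq_iff: "to_coord_ring a p = to_coord_ring a q \<longleftrightarrow> lin_pol a dvd p - q"
proof
  assume "to_coord_ring a p = to_coord_ring a q"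
  then have "p \<in> to_coord_ring a q" by (auto simp: to_coord_ring_eq)
  then show "lin_pol a dvd p - q" by (simp add: to_coord_ring_eq)
next
  assume d: "lin_pol a dvd p - q"
  have "lin_pol a dvd s - p \<longleftrightarrow> lin_pol a dvd s - q" for s
    using dvd_add_left_iff[OF d, of "s - p"] by simp
  then show "to_coord_ring a p = to_coord_ring a q" by (simp add: to_coord_ring_eq)
qed

lemma cring_coord_ring: "cring (coord_ring a)"
  unfolding coord_ring_def by (rule ideal.quotient_is_cring[OF ideal_PIdl_lin_pol cring_pol_ring])

lemma carrier_coord_ring: "carrier (coord_ring a) = range (to_coord_ring a)"
  by (auto simp: coord_ring_def to_coord_ring_def FactRing_def A_RCOSETS_def')

lemma to_coord_ring_hom: "to_coord_ring a \<in> ring_hom pol_ring (coord_ring a)"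
  using ideal.rcos_ring_hom[OF ideal_PIdl_lin_pol]
  by (simp add: to_coord_ring_def[abs_def] coord_ring_def)

lemma to_coord_ring_mult: "to_coord_ring a p \<otimes>\<^bsub>coord_ring a\<^esub> to_coord_ring a q = to_coord_ring a (p * q)"
  and to_coord_ring_add: "to_coord_ring a p \<oplus>\<^bsub>coord_ring a\<^esub> to_coord_ring a q = to_coord_ring a (p + q)"
  and to_coord_ring_one: "\<one>\<^bsub>coord_ring a\<^esub> = to_coord_ring a 1"
  using ring_hom_mult[OF to_coord_ring_hom] ring_hom_add[OF to_coord_ring_hom] ring_hom_one[OF to_coord_ring_hom]
  by simp_all

lemma to_coord_ring_zero: "\<zero>\<^bsub>coord_ring a\<^esub> = to_coord_ring a 0"
  using ring_hom_zero[OF to_coord_ring_hom cring.axioms(1)[OF cring_pol_ring] cring.axioms(1)[OF cring_coord_ring]]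
  by simp

end

section \<open>Residues of logarithmic forms\<close>

lemma linear_dependent_if_minors_zero:
  fixes c d :: "'k::field ^ 'n::finite"
  assumes "\<And>i j. c $ i * d $ j = c $ j * d $ i" "c \<noteq> 0"
  shows "d \<in> vec.span {c}"
proof -
  obtain i where i: "c $ i \<noteq> 0" using assms(2) by (auto simp: vec_eq_iff)
  have "d = (d $ i / c $ i) *s c"
    using assms(1)[of i] i by (simp add: vec_eq_iff field_simps)
  then show ?thesis by (metis insertI1 vec.span_base vec.span_scale)
qed

lemma basis_of_forms_ex:
  fixes h :: "'k::field ^ 'n::finite"
  assumes "h \<noteq> 0"
  shows "\<exists>b k. basis_of_forms b \<and> b k = h"
proof -
  define E where "E = vec.extend_basis {h}"
  have ind: "vec.independent {h}" using assms by simp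
  have E: "h \<in> E" "vec.independent E" "vec.span E = UNIV"
    using vec.extend_basis_superset[OF ind] vec.independent_extend_basis[OF ind] ind
    by (auto simp: E_def)
  have "finite E" using E(2) by (rule vec.finiteI_independent)
  moreover have "card E = CARD('n)"
    using vec.dim_eq_card[of E UNIV] E by (simp add: card_cart_basis)
  ultimately obtain b where b: "bij_betw b (UNIV :: 'n set) E"
    using finite_same_card_bij[of "UNIV :: 'n set" E] by auto
  moreover from this obtain k where "b k = h" using E(1) by (auto simp: bij_betw_def)
  ultimately show ?thesis using E unfolding basis_of_forms_def by (auto simp: bij_betw_def)
qed

text \<open>Contraction with \<open>u\<close> extracts the coefficient of d(b k) from a 1-form
  written in the basis.\<close>

lemma basis_of_forms_dual_vector:
  fixes b :: "'n::finite \<Rightarrow> 'k::field ^ 'n"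
  assumes "basis_of_forms b"
  obtains u :: "'n \<Rightarrow> 'k" where "\<And>j. (\<Sum>i\<in>UNIV. b j $ i * u i) = (if j = k then 1 else 0)"
proof -
  have b: "inj b" "vec.independent (range b)" using assms by (auto simp: basis_of_forms_def)
  obtain g :: "'k ^ 'n \<Rightarrow> 'k ^ 'n" where g: "Vector_Spaces.linear (*s) (*s) g"
    "\<forall>v\<in>range b. g v = (if v = b k then axis k 1 else 0)"
    using vec.linear_independent_extend[OF b(2), of "\<lambda>v. if v = b k then axis k 1 else 0"] by blast
  have "(\<Sum>i\<in>UNIV. b j $ i * g (axis i 1) $ k) = g (b j) $ k" for j
    by (subst linear_functional_sum[OF g(1), of "b j"]) simp
  moreover have "g (b j) $ k = (if j = k then 1 else 0)" for j
    using g(2) b(1) by (auto simp: inj_eq axis_def)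
  ultimately show ?thesis using that[of "\<lambda>i. g (axis i 1) $ k"] by simp
qed

lemma basis_of_forms_expand_axis:
  fixes b :: "'n::finite \<Rightarrow> 'k::field ^ 'n"
  assumes "basis_of_forms b"
  shows "\<exists>m. axis l 1 = (\<Sum>j\<in>UNIV. m j *s b j)"
proof -
  have b: "inj b" "axis l 1 \<in> vec.span (range b)" using assms by (auto simp: basis_of_forms_def)
  then obtain m where "axis l 1 = (\<Sum>v\<in>range b. m v *s v)"
    by (auto simp: vec.span_finite)
  then show ?thesis using b(1) by (intro exI[of _ "\<lambda>j. m (b j)"]) (simp add: sum.reindex)
qed

lemma to_fract_sum: "to_fract (\<Sum>i\<in>I. g i) = (\<Sum>i\<in>I. to_fract (g i))"
  by (induction I rule: infinite_finite_induct) (simp_all add: to_fract_add)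

context arrangement_with_hyperplane
begin

section \<open>Defining forms on \<open>H\<close> and division by them\<close>

lemma form_nonzero: "L \<in> A \<Longrightarrow> \<alpha> L \<noteq> 0"
proof
  assume L: "L \<in> A" "\<alpha> L = 0"
  then have "L = UNIV" using hyperplane_eq[of L] by (simp add: lin_form_zero)
  then show False using arr L(1) by (auto simp: arrangement_def linear_hyperplane_def)
qed

lemma annihilator_hyperplane: "annihilator x H = vec.span {\<alpha> H}"
  using hyperplane_eq[OF HA] by (intro annihilator_common_zeros[OF vs dual]) auto

lemma not_subset_hyperplane:
  assumes L: "L \<in> A" "L \<noteq> H"
  shows "\<not> H \<subseteq> L"
proof
  assume "H \<subseteq> L"
  then have "\<alpha> L \<in> vec.span {\<alpha> H}"
    using form_in_annihilator_iff[OF L(1), of H] by (simp add: annihilator_hyperplane)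
  then obtain a where a: "\<alpha> L = a *s \<alpha> H" by (auto simp: vec.span_singleton)
  then have "a \<noteq> 0" using form_nonzero[OF L(1)] by auto
  then have "L = H"
    using hyperplane_eq[OF L(1)] hyperplane_eq[OF HA] by (auto simp: a lin_form_scale)
  with L(2) show False ..
qed

lemma restricted_form_notin_span:
  assumes "Y \<in> restriction A H"
  shows "\<beta> Y \<notin> vec.span {\<alpha> H}"
proof
  assume "\<beta> Y \<in> vec.span {\<alpha> H}"
  then have "H \<subseteq> Y"
    using restricted_form_in_annihilator_iff[OF assms, of H] by (simp add: annihilator_hyperplane)
  then show False using assms not_subset_hyperplane by (auto simp: restriction_def)
qed

lemma annihilator_restricted_hyperplane:
  assumes "Y \<in> restriction A H"
  shows "annihilator x Y = vec.span {\<beta> Y, \<alpha> H}"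
proof -
  have "Y = {v. lin_form x (\<beta> Y) v = 0 \<and> lin_form x (\<alpha> H) v = 0}"
    using restricted_hyperplane_eq[OF assms] hyperplane_eq[OF HA] by blast
  then show ?thesis by (intro annihilator_common_zeros[OF vs dual]) auto
qed

text \<open>Modulo \<alpha> H the form of \<open>Z\<close> is a nonzero multiple of that of
  \<open>Y\<close>. Consequently the form of one restricted hyperplane never lies in the prime of
  another, so that one can divide by them in turn.\<close>

lemma restricted_hyperplane_subset_eq:
  assumes Y: "Y \<in> restriction A H" and Z: "Z \<in> restriction A H" and "Y \<subseteq> Z"
  shows "Y = Z"
proof -
  have "Y \<subseteq> H" "Z \<subseteq> H" using Y Z by (auto simp: restriction_def)
  then have "\<beta> Z \<in> vec.span {\<beta> Y, \<alpha> H}"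
    using restricted_form_in_annihilator_iff[OF Z, of Y] \<open>Y \<subseteq> Z\<close> by (simp add: annihilator_restricted_hyperplane[OF Y])
  then obtain a where a: "\<beta> Z - a *s \<beta> Y \<in> vec.span {\<alpha> H}" by (auto simp: vec.span_insert)
  then have "a \<noteq> 0" using restricted_form_notin_span[OF Z] by auto
  have "lin_form x (\<beta> Z) v = a * lin_form x (\<beta> Y) v" if "v \<in> H" for v
  proof -
    have "lin_form x (\<beta> Z - a *s \<beta> Y) v = 0"
      using a that unfolding annihilator_hyperplane[symmetric] by (simp add: annihilator_def)
    moreover have "lin_form x (\<beta> Z) v = lin_form x ((\<beta> Z - a *s \<beta> Y) + a *s \<beta> Y) v" by simp
    ultimately show ?thesis by (simp only: lin_form_add lin_form_scale add_0)
  qed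
  moreover have "v \<in> Y \<longleftrightarrow> v \<in> H \<and> lin_form x (\<beta> Y) v = 0" for v
    using restricted_hyperplane_eq[OF Y] by blast
  moreover have "v \<in> Z \<longleftrightarrow> v \<in> H \<and> lin_form x (\<beta> Z) v = 0" for v
    using restricted_hyperplane_eq[OF Z] by blast
  ultimately show ?thesis using \<open>a \<noteq> 0\<close> by auto
qed

text \<open>Modulo the ideal of \<open>Y = H \<inter> L\<close>, the form is p d\<alpha>_H and its
  wedge with d\<alpha>_L vanishes. So \<open>p\<close> times each 2x2 minor of the two forms lies in
  the ideal, and some minor is a nonzero constant because the forms are independent.\<close>

lemma residue_numerators_subset_flat_ideal:
  assumes B: "B \<subseteq> A" and Y: "Y \<in> restriction B H" and p: "p \<in> residue_numerators (\<alpha> ` B) (\<alpha> H)"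
  shows "p \<in> flat_ideal Y"
proof -
  obtain L where L: "L \<in> B" "L \<noteq> H" "Y = H \<inter> L" using Y by (auto simp: restriction_def)
  have LA: "L \<in> A" using L(1) B by blast
  have "\<alpha> L \<notin> vec.span {\<alpha> H}"
    using not_subset_hyperplane[OF LA L(2)] form_in_annihilator_iff[OF LA, of H] by (simp add: annihilator_hyperplane)
  then obtain i j where ij: "\<alpha> H $ i * \<alpha> L $ j \<noteq> \<alpha> H $ j * \<alpha> L $ i"
    using linear_dependent_if_minors_zero[OF _ form_nonzero[OF HA], of "\<alpha> L"] by blast
  obtain \<eta> where \<eta>: "\<eta> \<in> log_numerators (\<alpha> ` B)" "\<And>i. lin_pol (\<alpha> H) dvd \<eta> i - p * const_pol (\<alpha> H $ i)"
    using p by (rule residue_numeratorsE) blast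
  have "lin_pol (\<alpha> H) \<in> flat_ideal Y" "lin_pol (\<alpha> L) \<in> flat_ideal Y"
    using L by (auto simp: lin_pol_in_flat_ideal form_in_annihilator_iff HA LA)
  note H = is_ideal_dvd[OF is_ideal_flat_ideal this(1)] and L' = is_ideal_dvd[OF is_ideal_flat_ideal this(2)]
  let ?h = "\<lambda>i. const_pol (\<alpha> H $ i) :: ('n, 'k) pol" and ?c = "\<lambda>i. const_pol (\<alpha> L $ i) :: ('n, 'k) pol"
  have "\<eta> i * ?c j - \<eta> j * ?c i \<in> flat_ideal Y"
    using \<eta>(1) L(1) by (intro L') (simp add: log_numerators_def)
  from ring_mod.subspace_add[OF is_ideal_flat_ideal ring_mod.subspace_diff[OF is_ideal_flat_ideal this
        ring_mod.subspace_scale[OF is_ideal_flat_ideal H[OF \<eta>(2)]]]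
      ring_mod.subspace_scale[OF is_ideal_flat_ideal H[OF \<eta>(2)]]]
  have "(\<eta> i * ?c j - \<eta> j * ?c i) - ?c j * (\<eta> i - p * ?h i) + ?c i * (\<eta> j - p * ?h j) \<in> flat_ideal Y" .
  also have "(\<eta> i * ?c j - \<eta> j * ?c i) - ?c j * (\<eta> i - p * ?h i) + ?c i * (\<eta> j - p * ?h j)
      = p * (?h i * ?c j - ?h j * ?c i)"
    by (simp add: algebra_simps)
  also have "?h i * ?c j - ?h j * ?c i = const_pol (\<alpha> H $ i * \<alpha> L $ j - \<alpha> H $ j * \<alpha> L $ i)"
    by (simp add: unital_hom_minus[OF unital_hom_const_pol] unital_hom_mult[OF unital_hom_const_pol])
  finally have "p * const_pol (\<alpha> H $ i * \<alpha> L $ j - \<alpha> H $ j * \<alpha> L $ i) \<in> flat_ideal Y" .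
  from is_ideal_mult_right[OF is_ideal_flat_ideal this, of "const_pol (1 / (\<alpha> H $ i * \<alpha> L $ j - \<alpha> H $ j * \<alpha> L $ i))"]
  show ?thesis
    using ij by (simp add: mult.assoc unital_hom_one[OF unital_hom_const_pol] flip: unital_hom_mult[OF unital_hom_const_pol])
qed

text \<open>The quotient so far lies in the prime of the next \<open>Y\<close>, since the product
  already divided out does not; and this prime is generated by \<beta> Y and \<alpha> H.\<close>

lemma ex_quotient_mod_hyperplane:
  assumes "finite D" "D \<subseteq> restriction A H" "\<And>Y. Y \<in> D \<Longrightarrow> p \<in> flat_ideal Y"
  shows "\<exists>r. lin_pol (\<alpha> H) dvd p - defining_poly \<beta> D * r"
  using assms
proof (induction D)
  case empty
  show ?case by (rule exI[of _ p]) (simp add: defining_poly_def)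
next
  case (insert Y D)
  then obtain r where r: "lin_pol (\<alpha> H) dvd p - defining_poly \<beta> D * r" by auto
  have Y: "Y \<in> restriction A H" using insert.prems by simp
  have "Y \<subseteq> H" using Y by (auto simp: restriction_def)
  then have "lin_pol (\<alpha> H) \<in> flat_ideal Y"
    by (simp add: lin_pol_in_flat_ideal form_in_annihilator_iff HA)
  from ring_mod.subspace_diff[OF is_ideal_flat_ideal insert.prems(2) is_ideal_dvd[OF is_ideal_flat_ideal this r]]
  have "defining_poly \<beta> D * r \<in> flat_ideal Y" by simp
  moreover have "defining_poly \<beta> D \<notin> flat_ideal Y"
  proof
    assume "defining_poly \<beta> D \<in> flat_ideal Y"
    then obtain Z where Z: "Z \<in> D" "lin_pol (\<beta> Z) \<in> flat_ideal Y"
      using lin_ideal_prod[OF subspace_annihilator \<open>finite D\<close>] unfolding flat_ideal_def defining_poly_def by blast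
    then have "Y = Z"
      using insert.prems(1) \<open>Y \<subseteq> H\<close> restricted_hyperplane_subset_eq[OF Y, of Z]
      by (auto simp: lin_pol_in_flat_ideal restricted_form_in_annihilator_iff)
    then show False using Z(1) insert.hyps(2) by simp
  qed
  ultimately have "r \<in> flat_ideal Y" using flat_ideal_prime by blast
  then have "r \<in> ideal_span {lin_pol (\<beta> Y), lin_pol (\<alpha> H)}"
    unfolding flat_ideal_def annihilator_restricted_hyperplane[OF Y] lin_ideal_span by (simp add: lin_ideal_def)
  then obtain s where "r - s * lin_pol (\<beta> Y) \<in> ideal_span {lin_pol (\<alpha> H)}"
    by (auto simp: ring_mod.span_insert)
  then have s: "lin_pol (\<alpha> H) dvd r - s * lin_pol (\<beta> Y)"
    using lin_ideal_singleton[of "\<alpha> H"] by (auto simp: lin_ideal_def)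
  have "p - defining_poly \<beta> (insert Y D) * s
      = (p - defining_poly \<beta> D * r) + defining_poly \<beta> D * (r - s * lin_pol (\<beta> Y))"
    using insert.hyps by (simp add: defining_poly_def algebra_simps)
  moreover have "lin_pol (\<alpha> H) dvd \<dots>" by (intro dvd_add r dvd_mult s)
  ultimately show ?case by (intro exI[of _ s]) (simp only:)
qed

text \<open>Allows the restriction polynomial to be cancelled modulo \<alpha> H, which gives the
  uniqueness of residues.\<close>

lemma restriction_poly_not_dvd:
  assumes "B \<subseteq> A"
  shows "\<not> lin_pol (\<alpha> H) dvd defining_poly \<beta> (restriction B H)"
proof
  have fin: "finite (restriction B H)"
    using assms finite_A by (auto intro: finite_restriction finite_subset)
  assume "lin_pol (\<alpha> H) dvd defining_poly \<beta> (restriction B H)"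
  then have "(\<Prod>Y\<in>restriction B H. lin_pol (\<beta> Y)) \<in> lin_ideal (vec.span {\<alpha> H})"
    by (simp add: lin_ideal_span lin_ideal_singleton defining_poly_def)
  then obtain Y where Y: "Y \<in> restriction B H" "lin_pol (\<beta> Y) \<in> lin_ideal (vec.span {\<alpha> H})"
    using lin_ideal_prod[OF vec.subspace_span fin] by blast
  then show False
    using restricted_form_notin_span[of Y] restriction_mono[OF assms, of H]
    by (auto simp: lin_pol_in_lin_ideal[OF vec.subspace_span])
qed

section \<open>The residue map in terms of numerators\<close>

lemma defining_poly_nonzero: "B \<subseteq> A \<Longrightarrow> defining_poly \<alpha> B \<noteq> 0"
  using finite_subset[OF _ finite_A, of B] form_nonzero by (auto simp: defining_poly_def)

lemma log_forms_eq:
  assumes "B \<subseteq> A"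
  shows "log_forms \<alpha> B = (\<lambda>\<eta> i. to_fract (\<eta> i) / to_fract (defining_poly \<alpha> B)) ` log_numerators (\<alpha> ` B)"
    (is "_ = ?F ` _")
proof -
  let ?Q = "defining_poly \<alpha> B"
  have Q: "to_fract ?Q \<noteq> 0" using defining_poly_nonzero[OF assms] by simp
  have wedge_eq: "wedge (\<lambda>i. to_fract ?Q * ?F \<eta> i) (d_lin c)
      = (\<lambda>i j. to_fract (\<eta> i * const_pol (c $ j) - \<eta> j * const_pol (c $ i)))" for \<eta> c
    using Q by (auto simp: wedge_def d_lin_def to_fract_diff to_fract_mult)
  have cond: "(\<exists>\<theta>\<in>Omega2. wedge (\<lambda>i. to_fract ?Q * ?F \<eta> i) (d_lin (\<alpha> L))
          = (\<lambda>i j. to_fract (lin_pol (\<alpha> L)) * \<theta> i j))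
      \<longleftrightarrow> (\<forall>i j. lin_pol (\<alpha> L) dvd \<eta> i * const_pol (\<alpha> L $ j) - \<eta> j * const_pol (\<alpha> L $ i))"
    (is "?lhs \<longleftrightarrow> ?rhs") if L: "L \<in> B" for \<eta> L
  proof
    assume ?lhs
    then obtain \<theta> where "(\<lambda>i j. to_fract (\<eta> i * const_pol (\<alpha> L $ j) - \<eta> j * const_pol (\<alpha> L $ i)))
        = (\<lambda>i j. to_fract (lin_pol (\<alpha> L)) * to_fract (\<theta> i j))"
      unfolding wedge_eq by (auto simp: Omega2_def)
    then have "to_fract (\<eta> i * const_pol (\<alpha> L $ j) - \<eta> j * const_pol (\<alpha> L $ i)) = to_fract (lin_pol (\<alpha> L) * \<theta> i j)" for i j
      by (simp add: fun_eq_iff to_fract_mult)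
    then show ?rhs by (simp only: to_fract_eq_iff) (simp add: dvd_def)
  next
    assume ?rhs
    then have "\<forall>i j. \<exists>t. \<eta> i * const_pol (\<alpha> L $ j) - \<eta> j * const_pol (\<alpha> L $ i) = lin_pol (\<alpha> L) * t"
      by (simp add: dvd_def)
    then obtain \<theta> where \<theta>: "\<And>i j. \<eta> i * const_pol (\<alpha> L $ j) - \<eta> j * const_pol (\<alpha> L $ i) = lin_pol (\<alpha> L) * \<theta> i j"
      by metis
    have nz: "lin_pol (\<alpha> L) \<noteq> 0" using form_nonzero L assms by auto
    \<comment> \<open>The wedge is alternating and stays so after division by a nonzero form, so the
      quotients are the coefficients of a 2-form.\<close>
    have "lin_pol (\<alpha> L) * \<theta> i i = 0" for i
      unfolding \<theta>[symmetric] by simp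
    then have "\<theta> i i = 0" for i using nz by simp
    moreover have "lin_pol (\<alpha> L) * \<theta> i j = lin_pol (\<alpha> L) * (- \<theta> j i)" for i j
      unfolding mult_minus_right \<theta>[symmetric] by simp
    then have "\<theta> i j = - \<theta> j i" for i j using nz by (metis mult_left_cancel)
    ultimately have "(\<lambda>i j. to_fract (\<theta> i j)) \<in> Omega2" unfolding Omega2_def by blast
    then show ?lhs
      by (rule bexI[rotated]) (simp only: wedge_eq \<theta> to_fract_mult)
  qed
  have "\<omega> \<in> log_forms \<alpha> B \<longleftrightarrow> \<omega> \<in> ?F ` log_numerators (\<alpha> ` B)" for \<omega>
  proof
    assume w: "\<omega> \<in> log_forms \<alpha> B"
    then obtain \<eta> where \<eta>: "\<omega> = ?F \<eta>" by (auto simp: log_forms_def Omega1_def)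
    have "\<eta> \<in> log_numerators (\<alpha> ` B)"
      using w cond unfolding \<eta> log_forms_def log_numerators_def by simp
    then show "\<omega> \<in> ?F ` log_numerators (\<alpha> ` B)" using \<eta> by blast
  next
    assume "\<omega> \<in> ?F ` log_numerators (\<alpha> ` B)"
    then obtain \<eta> where \<eta>: "\<omega> = ?F \<eta>" "\<eta> \<in> log_numerators (\<alpha> ` B)" by blast
    have "\<exists>\<eta>'\<in>Omega1. ?F \<eta> = (\<lambda>i. (1 / to_fract ?Q) * \<eta>' i)"
      by (rule bexI[of _ "\<lambda>i. to_fract (\<eta> i)"]) (auto simp: Omega1_def)
    then show "\<omega> \<in> log_forms \<alpha> B"
      using \<eta>(2) cond unfolding \<eta>(1) log_forms_def log_numerators_def by simp
  qed
  then show ?thesis by blast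
qed

text \<open>Contracting \<open>\<eta>\<close> with the vector dual to \<open>b k\<close> gives
  \<open>p\<close>, and contracting q d\<alpha>_H gives \<open>q\<close>. Hence the residue does not
  depend on the basis.\<close>

lemma basis_coefficient_mod_hyperplane:
  assumes B: "B \<subseteq> A" and b: "basis_of_forms b" "b k = \<alpha> H"
    and f: "(\<lambda>i. to_fract (\<eta> i) / to_fract (defining_poly \<alpha> B)) = (\<lambda>i. \<Sum>j\<in>UNIV. f j * d_lin (b j) i)"
    and p: "to_fract (defining_poly \<alpha> B) * f k = to_fract p"
    and q: "\<And>i. lin_pol (\<alpha> H) dvd \<eta> i - q * const_pol (\<alpha> H $ i)"
  shows "lin_pol (\<alpha> H) dvd p - q"
proof -
  let ?Q = "to_fract (defining_poly \<alpha> B)"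
  have Q: "?Q \<noteq> 0" using defining_poly_nonzero[OF B] by simp
  obtain u where u: "\<And>j. (\<Sum>i\<in>UNIV. b j $ i * u i) = (if j = k then 1 else 0)"
    using basis_of_forms_dual_vector[OF b(1)] by metis
  have "to_fract (\<eta> i) = ?Q * (\<Sum>j\<in>UNIV. f j * d_lin (b j) i)" for i
    using fun_cong[OF f, of i] Q by (simp add: field_simps)
  then have "to_fract (\<Sum>i\<in>UNIV. const_pol (u i) * \<eta> i)
      = (\<Sum>i\<in>UNIV. \<Sum>j\<in>UNIV. ?Q * f j * to_fract (const_pol (b j $ i * u i)))"
    by (simp add: to_fract_sum to_fract_mult sum_distrib_left d_lin_def unital_hom_mult[OF unital_hom_const_pol] mult_ac)
  also have "\<dots> = (\<Sum>j\<in>UNIV. ?Q * f j * to_fract (const_pol (\<Sum>i\<in>UNIV. b j $ i * u i)))"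
    by (subst sum.swap) (simp add: unital_hom_sum[OF unital_hom_const_pol] to_fract_sum sum_distrib_left)
  also have "\<dots> = (\<Sum>j\<in>UNIV. if j = k then ?Q * f k else 0)"
    unfolding u
    by (intro sum.cong) (auto simp: unital_hom_one[OF unital_hom_const_pol] unital_hom_zero[OF unital_hom_const_pol])
  also have "\<dots> = to_fract p" by (simp add: p)
  finally have p_eq: "p = (\<Sum>i\<in>UNIV. const_pol (u i) * \<eta> i)" by (simp only: to_fract_eq_iff)
  have "(\<Sum>i\<in>UNIV. const_pol (\<alpha> H $ i * u i)) = (1 :: ('n, 'k) pol)"
    using u[of k] by (simp add: b(2) unital_hom_one[OF unital_hom_const_pol] flip: unital_hom_sum[OF unital_hom_const_pol])
  then have "q = (\<Sum>i\<in>UNIV. const_pol (u i) * (q * const_pol (\<alpha> H $ i)))"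
    by (simp add: unital_hom_mult[OF unital_hom_const_pol] mult_ac flip: sum_distrib_left)
  then have "p - q = (\<Sum>i\<in>UNIV. const_pol (u i) * (\<eta> i - q * const_pol (\<alpha> H $ i)))"
    unfolding p_eq right_diff_distrib sum_subtractf by simp
  also have "lin_pol (\<alpha> H) dvd \<dots>" by (intro dvd_sum dvd_mult q)
  finally show ?thesis .
qed

lemma residue_eq:
  assumes B: "B \<subseteq> A"
    and r: "\<And>i. lin_pol (\<alpha> H) dvd \<eta> i - defining_poly \<beta> (restriction B H) * r * const_pol (\<alpha> H $ i)"
  shows "residue \<alpha> \<beta> B H (\<lambda>i. to_fract (\<eta> i) / to_fract (defining_poly \<alpha> B)) = to_coord_ring (\<alpha> H) r"
proof -
  let ?\<omega> = "\<lambda>i. to_fract (\<eta> i) / to_fract (defining_poly \<alpha> B)" and ?t = "to_coord_ring (\<alpha> H)"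
  let ?Q = "defining_poly \<alpha> B" and ?QH = "defining_poly \<beta> (restriction B H)"
  have Q: "to_fract ?Q \<noteq> 0" using defining_poly_nonzero[OF B] by simp
  show ?thesis
    unfolding residue_def
  proof (rule the_equality)
    obtain b k where b: "basis_of_forms b" "b k = \<alpha> H"
      using basis_of_forms_ex[OF form_nonzero[OF HA]] by blast
    obtain m where m: "\<And>l. axis l 1 = (\<Sum>j\<in>UNIV. m l j *s b j)"
      using basis_of_forms_expand_axis[OF b(1)] by metis
    \<comment> \<open>The coefficients with respect to \<open>b\<close>, found by expanding each
      dx_l in this basis.\<close>
    define f where "f j = (\<Sum>l\<in>UNIV. ?\<omega> l * to_fract (const_pol (m l j)))" for j
    define p where "p = (\<Sum>l\<in>UNIV. \<eta> l * const_pol (m l k))"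
    have f: "?\<omega> = (\<lambda>i. \<Sum>j\<in>UNIV. f j * d_lin (b j) i)"
    proof
      fix i
      have "(\<Sum>j\<in>UNIV. f j * d_lin (b j) i)
          = (\<Sum>j\<in>UNIV. \<Sum>l\<in>UNIV. ?\<omega> l * to_fract (const_pol (m l j * b j $ i)))"
        unfolding f_def d_lin_def sum_distrib_right
        by (simp only: unital_hom_mult[OF unital_hom_const_pol] to_fract_mult mult.assoc)
      also have "\<dots> = (\<Sum>l\<in>UNIV. ?\<omega> l * to_fract (const_pol (\<Sum>j\<in>UNIV. m l j * b j $ i)))"
        by (subst sum.swap) (simp only: unital_hom_sum[OF unital_hom_const_pol] to_fract_sum sum_distrib_left)
      also have "\<dots> = (\<Sum>l\<in>UNIV. ?\<omega> l * to_fract (const_pol (axis l 1 $ i)))"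
        unfolding m by simp
      also have "\<dots> = (\<Sum>l\<in>UNIV. if l = i then ?\<omega> i else 0)"
        by (intro sum.cong) (auto simp: axis_def unital_hom_one[OF unital_hom_const_pol] unital_hom_zero[OF unital_hom_const_pol])
      also have "\<dots> = ?\<omega> i" by simp
      finally show "?\<omega> i = (\<Sum>j\<in>UNIV. f j * d_lin (b j) i)" by simp
    qed
    have p: "to_fract ?Q * f k = to_fract p"
      using Q by (simp add: f_def p_def to_fract_sum to_fract_mult sum_distrib_left)
    have "lin_pol (\<alpha> H) dvd p - ?QH * r"
      by (rule basis_coefficient_mod_hyperplane[OF B b f p r])
    then have "lin_pol (\<alpha> H) dvd ?QH * r - p"
      by (metis dvd_minus_iff minus_diff_eq)
    then have "?t ?QH \<otimes>\<^bsub>coord_ring (\<alpha> H)\<^esub> ?t r = ?t p"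
      by (simp add: to_coord_ring_mult to_coord_ring_eq_iff)
    then show "?t r \<in> carrier (coord_ring (\<alpha> H)) \<and> (\<exists>b k f p. basis_of_forms b \<and> b k = \<alpha> H \<and>
        ?\<omega> = (\<lambda>i. \<Sum>j\<in>UNIV. f j * d_lin (b j) i) \<and> to_fract ?Q * f k = to_fract p \<and>
        ?t ?QH \<otimes>\<^bsub>coord_ring (\<alpha> H)\<^esub> ?t r = ?t p)"
      using b f p by (auto simp only: carrier_coord_ring)
  next
    fix r' assume "r' \<in> carrier (coord_ring (\<alpha> H)) \<and> (\<exists>b k f p. basis_of_forms b \<and> b k = \<alpha> H \<and>
        ?\<omega> = (\<lambda>i. \<Sum>j\<in>UNIV. f j * d_lin (b j) i) \<and> to_fract ?Q * f k = to_fract p \<and>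
        ?t ?QH \<otimes>\<^bsub>coord_ring (\<alpha> H)\<^esub> r' = ?t p)"
    then obtain s b k f p where r': "r' = ?t s" and *: "basis_of_forms b" "b k = \<alpha> H"
      "?\<omega> = (\<lambda>i. \<Sum>j\<in>UNIV. f j * d_lin (b j) i)" "to_fract ?Q * f k = to_fract p"
      "?t ?QH \<otimes>\<^bsub>coord_ring (\<alpha> H)\<^esub> r' = ?t p"
      unfolding carrier_coord_ring by blast
    have "lin_pol (\<alpha> H) dvd p - ?QH * r"
      by (rule basis_coefficient_mod_hyperplane[OF B *(1-4) r])
    moreover have "lin_pol (\<alpha> H) dvd ?QH * s - p"
      using *(5) by (simp add: r' to_coord_ring_mult to_coord_ring_eq_iff)
    ultimately have "lin_pol (\<alpha> H) dvd (?QH * s - p) + (p - ?QH * r)" by (rule dvd_add[rotated])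
    then have "lin_pol (\<alpha> H) dvd ?QH * (s - r)" by (simp add: algebra_simps)
    then have "lin_pol (\<alpha> H) dvd s - r"
      using lin_pol_dvd_mult restriction_poly_not_dvd[OF B] by blast
    then show "r' = ?t r" by (simp add: r' to_coord_ring_eq_iff)
  qed
qed

lemma residue_ideal_eq:
  assumes B: "B \<subseteq> A" "H \<in> B"
  shows "residue_ideal \<alpha> \<beta> B H = to_coord_ring (\<alpha> H) ` lifted_ideal B"
proof (intro equalityI subsetI)
  let ?QH = "defining_poly \<beta> (restriction B H)"
  fix z assume "z \<in> residue_ideal \<alpha> \<beta> B H"
  then obtain \<eta> where \<eta>: "\<eta> \<in> log_numerators (\<alpha> ` B)"
    and z: "z = residue \<alpha> \<beta> B H (\<lambda>i. to_fract (\<eta> i) / to_fract (defining_poly \<alpha> B))"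
    unfolding residue_ideal_def log_forms_eq[OF B(1)] by blast
  obtain i where i: "\<alpha> H $ i \<noteq> 0" using form_nonzero[OF HA] by (auto simp: vec_eq_iff)
  \<comment> \<open>The logarithmic condition along \<open>H\<close> itself forces the form to be p
    d\<alpha>_H modulo \<alpha> H; the factor is read off at a nonzero coefficient of \<alpha>
    H.\<close>
  define p where "p = \<eta> i * const_pol (1 / \<alpha> H $ i)"
  have p: "lin_pol (\<alpha> H) dvd \<eta> j - p * const_pol (\<alpha> H $ j)" for j
  proof -
    have "lin_pol (\<alpha> H) dvd (\<eta> j * const_pol (\<alpha> H $ i) - \<eta> i * const_pol (\<alpha> H $ j)) * const_pol (1 / \<alpha> H $ i)"
      (is "_ dvd ?d") using \<eta> B(2) by (intro dvd_mult2) (simp add: log_numerators_def)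
    moreover have "const_pol (\<alpha> H $ i) * const_pol (1 / \<alpha> H $ i) = (1 :: ('n, 'k) pol)"
      using i by (simp add: unital_hom_one[OF unital_hom_const_pol] flip: unital_hom_mult[OF unital_hom_const_pol])
    moreover have "?d = \<eta> j * (const_pol (\<alpha> H $ i) * const_pol (1 / \<alpha> H $ i)) - p * const_pol (\<alpha> H $ j)"
      by (simp add: p_def algebra_simps)
    ultimately show ?thesis by simp
  qed
  have "p \<in> residue_numerators (\<alpha> ` B) (\<alpha> H)" using \<eta> p by (rule residue_numeratorsI)
  \<comment> \<open>The numerator lies in the primes of all restricted hyperplanes, hence is
    divisible by their product modulo \<alpha> H: the residue has no poles.\<close>
  then obtain r where r: "lin_pol (\<alpha> H) dvd p - ?QH * r"
    using ex_quotient_mod_hyperplane[of "restriction B H" p] residue_numerators_subset_flat_ideal[OF B(1)]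
      finite_restriction[OF finite_subset[OF B(1) finite_A]] restriction_mono[OF B(1)] by blast
  have r': "lin_pol (\<alpha> H) dvd \<eta> j - ?QH * r * const_pol (\<alpha> H $ j)" for j
  proof -
    have "\<eta> j - ?QH * r * const_pol (\<alpha> H $ j)
        = (\<eta> j - p * const_pol (\<alpha> H $ j)) + (p - ?QH * r) * const_pol (\<alpha> H $ j)"
      by (simp add: algebra_simps)
    then show ?thesis using dvd_add[OF p dvd_mult2[OF r]] by (simp only:)
  qed
  then have "r \<in> lifted_ideal B"
    unfolding lifted_ideal_def using \<eta> by (auto intro: residue_numeratorsI)
  then show "z \<in> to_coord_ring (\<alpha> H) ` lifted_ideal B"
    unfolding z residue_eq[OF B(1) r'] by blast
next
  fix z assume "z \<in> to_coord_ring (\<alpha> H) ` lifted_ideal B"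
  then obtain r where r: "r \<in> lifted_ideal B" "z = to_coord_ring (\<alpha> H) r" by blast
  from r(1) have "defining_poly \<beta> (restriction B H) * r \<in> residue_numerators (\<alpha> ` B) (\<alpha> H)"
    by (simp add: lifted_ideal_def)
  then obtain \<eta> where \<eta>: "\<eta> \<in> log_numerators (\<alpha> ` B)"
    "\<And>i. lin_pol (\<alpha> H) dvd \<eta> i - defining_poly \<beta> (restriction B H) * r * const_pol (\<alpha> H $ i)"
    by (rule residue_numeratorsE) blast
  show "z \<in> residue_ideal \<alpha> \<beta> B H"
    unfolding residue_ideal_def log_forms_eq[OF B(1)] r(2) residue_eq[OF B(1) \<eta>(2), symmetric]
    using \<eta>(1) by blast
qed

end

section \<open>Transfer to the coordinate ring\<close>

lemma associated_primes_iff: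
  fixes R (structure)
  assumes "cring R" and J: "ideal J R"
  shows "P \<in> associated_primes R J \<longleftrightarrow> primeideal P R \<and>
    (\<exists>m\<in>carrier R. P = {r \<in> carrier R. r \<otimes>\<^bsub>R\<^esub> m \<in> J})"
proof -
  interpret cring R by (rule assms(1))
  interpret ideal J R by (rule J)
  have "(J +> r) \<otimes>\<^bsub>R Quot J\<^esub> (J +> m) = \<zero>\<^bsub>R Quot J\<^esub> \<longleftrightarrow> r \<otimes> m \<in> J"
    if rm: "r \<in> carrier R" "m \<in> carrier R" for r m
  proof -
    have "(J +> r) \<otimes>\<^bsub>R Quot J\<^esub> (J +> m) = J +> (r \<otimes> m)"
      using rcoset_mult_add[OF rm] by (simp add: FactRing_def)
    moreover have "J +> (r \<otimes> m) = J \<longleftrightarrow> r \<otimes> m \<in> J"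
      using a_rcos_const a_rcos_self[of "r \<otimes> m"] rm by auto
    ultimately show ?thesis by (simp add: FactRing_def)
  qed
  then have eq: "{r \<in> carrier R. (J +> r) \<otimes>\<^bsub>R Quot J\<^esub> (J +> m) = \<zero>\<^bsub>R Quot J\<^esub>} = {r \<in> carrier R. r \<otimes> m \<in> J}"
    if "m \<in> carrier R" for m
    using that by blast
  have carr: "carrier (R Quot J) = (\<lambda>m. J +> m) ` carrier R"
    by (auto simp: FactRing_def A_RCOSETS_def')
  show ?thesis
    unfolding associated_primes_def carr by (simp add: eq cong: bex_cong)
qed

context arrangement_with_hyperplane
begin

abbreviation "R \<equiv> coord_ring (\<alpha> H)"
abbreviation "proj \<equiv> to_coord_ring (\<alpha> H)"

text \<open>The kernel of \<open>proj\<close> is generated by the form of \<open>H\<close>, so an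
  ideal containing this form is a full preimage.\<close>

lemma proj_in_image_iff:
  assumes I: "is_ideal I" "lin_pol (\<alpha> H) \<in> I"
  shows "proj p \<in> proj ` I \<longleftrightarrow> p \<in> I"
proof
  assume "proj p \<in> proj ` I"
  then obtain q where q: "q \<in> I" "lin_pol (\<alpha> H) dvd p - q" by (auto simp: to_coord_ring_eq_iff)
  then have "(p - q) + q \<in> I"
    using is_ideal_dvd[OF I] by (intro ring_mod.subspace_add[OF I(1)])
  then show "p \<in> I" by simp
qed blast

lemma ideal_proj_image:
  assumes I: "is_ideal I"
  shows "ideal (proj ` I) R"
proof (rule idealI)
  interpret R: cring R by (rule cring_coord_ring)
  show "ring R" by (rule R.ring_axioms)
  show "subgroup (proj ` I) (add_monoid R)"
  proof
    show "proj ` I \<subseteq> carrier (add_monoid R)" by (auto simp: carrier_coord_ring)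
    show "z \<otimes>\<^bsub>add_monoid R\<^esub> y \<in> proj ` I" if "z \<in> proj ` I" "y \<in> proj ` I" for z y
      using that ring_mod.subspace_add[OF I] by (auto simp: to_coord_ring_add)
    show "\<one>\<^bsub>add_monoid R\<^esub> \<in> proj ` I"
      using ring_mod.subspace_0[OF I] by (auto simp: to_coord_ring_zero)
    show "inv\<^bsub>add_monoid R\<^esub> z \<in> proj ` I" if z: "z \<in> proj ` I" for z
    proof -
      obtain p where p: "p \<in> I" "z = proj p" using z by blast
      have "\<ominus>\<^bsub>R\<^esub> z = proj (- p)"
        by (rule R.minus_equality) (auto simp: p(2) carrier_coord_ring to_coord_ring_add to_coord_ring_zero)
      then show ?thesis using p(1) ring_mod.subspace_neg[OF I] by (auto simp: a_inv_def)
    qed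
  qed
  fix z y assume "z \<in> proj ` I" "y \<in> carrier R"
  then obtain p q where p: "p \<in> I" "z = proj p" "y = proj q" by (auto simp: carrier_coord_ring)
  show "y \<otimes>\<^bsub>R\<^esub> z \<in> proj ` I" "z \<otimes>\<^bsub>R\<^esub> y \<in> proj ` I"
    using p ring_mod.subspace_scale[OF I p(1)] is_ideal_mult_right[OF I p(1)]
    by (auto simp: to_coord_ring_mult)
qed

lemma proj_image_eq_carrier_iff:
  assumes I: "is_ideal I" "lin_pol (\<alpha> H) \<in> I"
  shows "proj ` I = carrier R \<longleftrightarrow> 1 \<in> I"
proof
  assume "proj ` I = carrier R"
  then have "proj 1 \<in> proj ` I" by (simp add: carrier_coord_ring)
  then show "1 \<in> I" by (simp add: proj_in_image_iff[OF I])
next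
  assume "1 \<in> I"
  then have "I = UNIV" using is_ideal_dvd[OF I(1), of 1] by auto
  then show "proj ` I = carrier R" by (simp add: carrier_coord_ring)
qed

lemma proj_power: "proj p [^]\<^bsub>R\<^esub> n = proj (p ^ n)"
proof -
  interpret R: cring R by (rule cring_coord_ring)
  show ?thesis
    by (induction n) (simp_all add: to_coord_ring_one to_coord_ring_mult mult.commute)
qed

lemma vimage_proj_is_ideal:
  assumes "ideal K R"
  shows "is_ideal {p. proj p \<in> K}"
proof -
  interpret ideal K R by (rule assms)
  show ?thesis
    unfolding ring_mod.subspace_def
  proof safe
    show "proj 0 \<in> K" using additive_subgroup.zero_closed[OF additive_subgroup_axioms] by (simp add: to_coord_ring_zero)
    show "proj (p + q) \<in> K" if "proj p \<in> K" "proj q \<in> K" for p q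
      using additive_subgroup.a_closed[OF additive_subgroup_axioms that] by (simp add: to_coord_ring_add)
    show "proj (c * p) \<in> K" if "proj p \<in> K" for c p
      using I_l_closed[OF that, of "proj c"] by (simp add: to_coord_ring_mult carrier_coord_ring)
  qed
qed

lemma form_in_flat_ideal: "X \<subseteq> H \<Longrightarrow> lin_pol (\<alpha> H) \<in> flat_ideal X"
  by (simp add: lin_pol_in_flat_ideal form_in_annihilator_iff HA)

lemma subspace_ideal_eq: "subspace_ideal x (\<alpha> H) X = proj ` flat_ideal X"
proof -
  interpret R: cring R by (rule cring_coord_ring)
  let ?S = "{proj (lin_pol c) | c. \<forall>v\<in>X. lin_form x c v = 0}"
  have S: "?S \<subseteq> carrier R" by (auto simp: carrier_coord_ring)
  have "Idl\<^bsub>R\<^esub> ?S \<subseteq> proj ` flat_ideal X"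
  proof (rule R.genideal_minimal[OF ideal_proj_image[OF is_ideal_flat_ideal]])
    show "?S \<subseteq> proj ` flat_ideal X" by (auto simp: lin_pol_in_flat_ideal annihilator_def)
  qed
  moreover have "flat_ideal X \<subseteq> {p. proj p \<in> Idl\<^bsub>R\<^esub> ?S}"
    unfolding flat_ideal_def
    using R.genideal_self[OF S]
    by (intro lin_ideal_minimal vimage_proj_is_ideal R.genideal_ideal[OF S]) (auto simp: annihilator_def)
  ultimately show ?thesis unfolding subspace_ideal_def by blast
qed

lemma primeideal_flat_ideal:
  assumes "lin_pol (\<alpha> H) \<in> flat_ideal X"
  shows "primeideal (proj ` flat_ideal X) R"
proof (rule primeidealI[OF ideal_proj_image[OF is_ideal_flat_ideal] cring_coord_ring])
  note iff = proj_in_image_iff[OF is_ideal_flat_ideal assms]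
  show "carrier R \<noteq> proj ` flat_ideal X"
    using proj_image_eq_carrier_iff[OF is_ideal_flat_ideal assms] one_notin_flat_ideal by blast
  fix a b assume "a \<in> carrier R" "b \<in> carrier R" "a \<otimes>\<^bsub>R\<^esub> b \<in> proj ` flat_ideal X"
  moreover from this obtain p q where pq: "a = proj p" "b = proj q" by (auto simp: carrier_coord_ring)
  ultimately have "p * q \<in> flat_ideal X" by (simp add: to_coord_ring_mult iff)
  then show "a \<in> proj ` flat_ideal X \<or> b \<in> proj ` flat_ideal X"
    using flat_ideal_prime unfolding pq iff by blast
qed

lemma associated_primes_proj_iff:
  "P \<in> associated_primes R (proj ` lifted_ideal A) \<longleftrightarrow>
    primeideal P R \<and> (\<exists>m. P = proj ` {p. p * m \<in> lifted_ideal A})"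
proof -
  note iff = proj_in_image_iff[OF is_ideal_lifted_ideal form_in_lifted_ideal]
  have "{r \<in> carrier R. r \<otimes>\<^bsub>R\<^esub> proj m \<in> proj ` lifted_ideal A}
      = proj ` {p. proj p \<otimes>\<^bsub>R\<^esub> proj m \<in> proj ` lifted_ideal A}" for m
    unfolding carrier_coord_ring by blast
  then have "{r \<in> carrier R. r \<otimes>\<^bsub>R\<^esub> proj m \<in> proj ` lifted_ideal A} = proj ` {p. p * m \<in> lifted_ideal A}" for m
    by (simp only: to_coord_ring_mult iff)
  then show ?thesis
    by (simp add: associated_primes_iff[OF cring_coord_ring ideal_proj_image[OF is_ideal_lifted_ideal]] carrier_coord_ring)
qed

lemma subspace_restriction_flat:
  assumes "X \<in> restriction_flats A H"
  shows "module.subspace scl X"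
proof -
  interpret V: vector_space scl by (rule vs)
  have "V.subspace (\<Inter>(localization A X))"
    using arr by (intro V.subspace_Inter) (auto simp: localization_def arrangement_def linear_hyperplane_def)
  then show ?thesis by (simp flip: restriction_flat_eq_Inter[OF assms HA])
qed

lemma Xi_eq: "Xi \<alpha> \<beta> A H = proper_flats"
proof -
  have "residue_ideal \<alpha> \<beta> (localization A X) H \<noteq> carrier R \<longleftrightarrow> 1 \<notin> lifted_ideal (localization A X)"
    if "X \<in> restriction_flats A H" for X
    using residue_ideal_eq[of "localization A X"] restriction_flats_subset[OF that] HA
      proj_image_eq_carrier_iff[OF is_ideal_lifted_ideal form_in_lifted_ideal]
    by (simp add: localization_def)
  then show ?thesis by (auto simp: Xi_def proper_flats_def)
qed

lemma flat_ideal_eq_if_proj_eq: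
  assumes "lin_pol (\<alpha> H) \<in> flat_ideal X" "lin_pol (\<alpha> H) \<in> flat_ideal Y"
    and "proj ` flat_ideal X = proj ` flat_ideal Y"
  shows "flat_ideal X = flat_ideal Y"
proof (rule Set.set_eqI)
  fix p
  show "p \<in> flat_ideal X \<longleftrightarrow> p \<in> flat_ideal Y"
    using proj_in_image_iff[OF is_ideal_flat_ideal assms(1), of p]
      proj_in_image_iff[OF is_ideal_flat_ideal assms(2), of p] assms(3) by simp
qed

lemma associated_prime_is_proper_flat:
  assumes "P \<in> associated_primes R (proj ` lifted_ideal A)"
  shows "\<exists>X\<in>proper_flats. P = proj ` flat_ideal X"
proof -
  obtain m where m: "primeideal P R" "P = proj ` {p. p * m \<in> lifted_ideal A}"
    using assms by (auto simp: associated_primes_proj_iff)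
  define P0 where "P0 = {p. p * m \<in> lifted_ideal A}"
  interpret primeideal P R by (rule m(1))
  have iff: "proj p \<in> P \<longleftrightarrow> p \<in> P0" for p
  proof -
    have "proj p \<in> P \<longleftrightarrow> proj (p * m) \<in> proj ` lifted_ideal A"
    proof
      assume "proj p \<in> P"
      then obtain q where q: "proj p = proj q" "q * m \<in> lifted_ideal A" using m(2) by blast
      have "proj (p * m) = proj (q * m)"
        using arg_cong[OF q(1), of "\<lambda>z. z \<otimes>\<^bsub>R\<^esub> proj m"] by (simp add: to_coord_ring_mult)
      then show "proj (p * m) \<in> proj ` lifted_ideal A" using q(2) by simp
    next
      assume "proj (p * m) \<in> proj ` lifted_ideal A"
      then show "proj p \<in> P"
        unfolding m(2) by (simp add: proj_in_image_iff[OF is_ideal_lifted_ideal form_in_lifted_ideal])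
    qed
    then show ?thesis
      by (simp add: P0_def proj_in_image_iff[OF is_ideal_lifted_ideal form_in_lifted_ideal])
  qed
  have "\<exists>X\<in>proper_flats. P0 = flat_ideal X"
  proof (rule prime_colon_lifted_ideal[OF P0_def])
    show "a \<in> P0 \<or> b \<in> P0" if "a * b \<in> P0" for a b
      using I_prime[of "proj a" "proj b"] that by (simp add: carrier_coord_ring to_coord_ring_mult iff)
    show "1 \<notin> P0"
    proof
      assume "1 \<in> P0"
      then have "\<one>\<^bsub>R\<^esub> \<in> P" by (simp add: to_coord_ring_one iff)
      then show False using one_imp_carrier I_notcarr by simp
    qed
  qed
  then show ?thesis using m(2) unfolding P0_def by blast
qed

lemma residue_ideal_decomposition:
  defines "J \<equiv> residue_ideal \<alpha> \<beta> A H"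
    and "JX \<equiv> \<lambda>X. residue_ideal \<alpha> \<beta> (localization A X) H"
    and "P \<equiv> subspace_ideal x (\<alpha> H)"
  defines "I \<equiv> {X. module.subspace scl X \<and> X \<subseteq> H \<and> P X \<in> associated_primes R J}"
  shows "ideal_radical R J = ideal_INT R (Xi \<alpha> \<beta> A H) P"
    and "associated_primes R J \<subseteq> P ` Xi \<alpha> \<beta> A H"
    and "J = ideal_INT R I JX"
    and "embedded_primes R J = {} \<Longrightarrow> primary_decomposition R J I JX"
proof -
  have P: "P X = proj ` flat_ideal X" for X by (simp add: P_def subspace_ideal_eq)
  have J: "J = proj ` lifted_ideal A" unfolding J_def by (rule residue_ideal_eq[OF order.refl HA])
  have JX: "JX X = proj ` lifted_ideal (localization A X)" if "X \<subseteq> H" for X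
    unfolding JX_def using that HA by (intro residue_ideal_eq) (auto simp: localization_def)
  note J_iff = proj_in_image_iff[OF is_ideal_lifted_ideal form_in_lifted_ideal]
  have P_iff: "proj p \<in> P X \<longleftrightarrow> p \<in> flat_ideal X" if "X \<subseteq> H" for p X
    unfolding P by (rule proj_in_image_iff[OF is_ideal_flat_ideal form_in_flat_ideal[OF that]])
  have proper_H: "X \<subseteq> H" if "X \<in> proper_flats" for X
    using that restriction_flats_subset by (auto simp: proper_flats_def)
  show "ideal_radical R J = ideal_INT R (Xi \<alpha> \<beta> A H) P"
  proof -
    have "proj p \<in> ideal_radical R J \<longleftrightarrow> proj p \<in> ideal_INT R (Xi \<alpha> \<beta> A H) P" for p
    proof -
      have "proj p \<in> ideal_radical R J \<longleftrightarrow> (\<exists>k. p ^ k \<in> lifted_ideal A)"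
        by (simp add: ideal_radical_def carrier_coord_ring proj_power J J_iff)
      also have "\<dots> \<longleftrightarrow> proj p \<in> ideal_INT R (Xi \<alpha> \<beta> A H) P"
        using proper_H P_iff by (auto simp: power_in_lifted_ideal_iff ideal_INT_def Xi_eq carrier_coord_ring)
      finally show ?thesis .
    qed
    moreover have "ideal_radical R J \<subseteq> range proj" "ideal_INT R (Xi \<alpha> \<beta> A H) P \<subseteq> range proj"
      by (auto simp: ideal_radical_def ideal_INT_def carrier_coord_ring)
    ultimately show ?thesis by blast
  qed
  show "associated_primes R J \<subseteq> P ` Xi \<alpha> \<beta> A H"
    using associated_prime_is_proper_flat unfolding J Xi_eq P by blast
  \<comment> \<open>A subspace whose ideal is associated shares this ideal with a proper flat. The
    linear forms in the ideal are the annihilator, which determines the subspace.\<close>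
  have I_proper: "I \<subseteq> proper_flats"
  proof
    fix X assume X: "X \<in> I"
    then obtain Y where Y: "Y \<in> proper_flats" "P X = proj ` flat_ideal Y"
      using associated_prime_is_proper_flat[of "P X"] by (auto simp: I_def J)
    have "flat_ideal X = flat_ideal Y"
      using X Y(2) proper_H[OF Y(1)] by (intro flat_ideal_eq_if_proj_eq form_in_flat_ideal) (auto simp: I_def P)
    then have "annihilator x X = annihilator x Y"
      using lin_pol_in_flat_ideal by blast
    then have "X = Y"
      using X Y(1) by (intro annihilator_inject[OF vs dual]) (auto simp: I_def proper_flats_def subspace_restriction_flat)
    then show "X \<in> proper_flats" using Y(1) by simp
  qed
  have I_H: "X \<subseteq> H" if "X \<in> I" for X using that by (simp add: I_def)
  show decomposition: "J = ideal_INT R I JX"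
  proof
    show "J \<subseteq> ideal_INT R I JX"
    proof
      fix z assume "z \<in> J"
      then obtain p where p: "p \<in> lifted_ideal A" "z = proj p" by (auto simp: J)
      have "z \<in> JX X" if "X \<in> I" for X
        using lifted_ideal_localization_superset[OF order.refl I_H[OF that]] p by (auto simp: JX[OF I_H[OF that]])
      then show "z \<in> ideal_INT R I JX" by (simp add: ideal_INT_def p(2) carrier_coord_ring)
    qed
    show "ideal_INT R I JX \<subseteq> J"
    proof
      fix z assume z: "z \<in> ideal_INT R I JX"
      then obtain m where m: "z = proj m" by (auto simp: ideal_INT_def carrier_coord_ring)
      have "m \<in> lifted_ideal A"
      proof (rule ccontr)
        assume "m \<notin> lifted_ideal A"
        then obtain X s where X: "X \<in> restriction_flats A H" "m \<notin> lifted_ideal (localization A X)"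
          and s: "{p. p * (s * m) \<in> lifted_ideal A} = flat_ideal X"
          using ex_colon_lifted_ideal by blast
        have XH: "X \<subseteq> H" using X(1) by (rule restriction_flats_subset)
        have "P X \<in> associated_primes R J"
          unfolding P J associated_primes_proj_iff
          using primeideal_flat_ideal[OF form_in_flat_ideal[OF XH]] s by blast
        then have "X \<in> I" using XH subspace_restriction_flat[OF X(1)] by (simp add: I_def)
        then have "proj m \<in> JX X" using z m by (simp add: ideal_INT_def)
        then show False using X(2) by (simp add: JX[OF XH] J_iff)
      qed
      then show "z \<in> J" by (simp add: m J)
    qed
  qed
  assume embedded: "embedded_primes R J = {}"
  have "primary_ideal R (JX X)" if X: "X \<in> I" for X
    unfolding primary_ideal_def
  proof (intro conjI ballI impI)
    note XH = I_H[OF X]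
    have proper: "X \<in> proper_flats" using X I_proper by blast
    show "ideal (JX X) R" unfolding JX[OF XH] by (rule ideal_proj_image[OF is_ideal_lifted_ideal])
    show "JX X \<noteq> carrier R"
      using proper by (simp add: JX[OF XH] proj_image_eq_carrier_iff[OF is_ideal_lifted_ideal form_in_lifted_ideal] proper_flats_def)
    fix y z assume "y \<in> carrier R" "z \<in> carrier R" and yz: "y \<otimes>\<^bsub>R\<^esub> z \<in> JX X"
    then obtain a b where ab: "y = proj a" "z = proj b" by (auto simp: carrier_coord_ring)
    have ba: "b * a \<in> lifted_ideal (localization A X)"
      using yz by (simp add: ab JX[OF XH] to_coord_ring_mult J_iff mult.commute)
    show "y \<in> JX X \<or> z \<in> ideal_radical R (JX X)"
    \<comment> \<open>The factor \<open>b\<close> is either cancelled by saturation or, in the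
      absence of embedded primes, nilpotent modulo the local ideal.\<close>
    proof (cases "b \<in> flat_ideal X")
      case False
      then have "a \<in> lifted_ideal (localization A X)"
        using lifted_ideal_saturated[OF XH order.refl _ ba] by blast
      then show ?thesis by (simp add: ab JX[OF XH])
    next
      case True
      have minimal: "minimal_prime_over R J (P X)"
        using X embedded by (auto simp: embedded_primes_def I_def)
      have "\<exists>k. b ^ k \<in> lifted_ideal (localization A X)"
      proof (rule power_in_localized_ideal[OF proper True])
        fix Y assume Y: "lifted_ideal A \<subseteq> flat_ideal Y" "flat_ideal Y \<subseteq> flat_ideal X"
        then have form: "lin_pol (\<alpha> H) \<in> flat_ideal Y" using form_in_lifted_ideal by blast
        have "J \<subseteq> proj ` flat_ideal Y" "proj ` flat_ideal Y \<subseteq> P X"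
          unfolding J P by (rule image_mono[OF Y(1)], rule image_mono[OF Y(2)])
        then have "proj ` flat_ideal Y = P X"
          using minimal primeideal_flat_ideal[OF form] unfolding minimal_prime_over_def by simp
        then show "flat_ideal Y = flat_ideal X"
          using form form_in_flat_ideal[OF XH] by (intro flat_ideal_eq_if_proj_eq) (simp_all add: P)
      qed
      then show ?thesis
        by (simp add: ab ideal_radical_def carrier_coord_ring proj_power JX[OF XH] J_iff)
    qed
  qed
  moreover have "finite I"
    using I_proper finite_restriction_flats[OF finite_A] by (auto simp: proper_flats_def intro: finite_subset)
  ultimately show "primary_decomposition R J I JX"
    using decomposition by (simp add: primary_decomposition_def)
qed

end

theorem theorem1p2:
  fixes scl :: "'k::field \<Rightarrow> 'v::ab_group_add \<Rightarrow> 'v"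
    and x :: "'n::{finite,linorder} \<Rightarrow> 'v \<Rightarrow> 'k"
    and A :: "'v set set" and H :: "'v set"
    and \<alpha> \<beta> :: "'v set \<Rightarrow> 'k ^ 'n::{finite,linorder}"
  assumes "vector_space scl"
    and "vector_space.dim scl UNIV = CARD('n)"
    and "dual_basis scl x"
    and "arrangement scl A"
    and "H \<in> A"
    and "defining_forms x UNIV A \<alpha>"
    and "defining_forms x H (restriction A H) \<beta>"
  shows
    "let R = coord_ring (\<alpha> H);
         J = residue_ideal \<alpha> \<beta> A H;
         JX = (\<lambda>X. residue_ideal \<alpha> \<beta> (localization A X) H);
         P = subspace_ideal x (\<alpha> H);
         I = {X. module.subspace scl X \<and> X \<subseteq> H \<and> P X \<in> associated_primes R J}
     in ideal_radical R J = ideal_INT R (Xi \<alpha> \<beta> A H) P \<and>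
        associated_primes R J \<subseteq> P ` Xi \<alpha> \<beta> A H \<and>
        J = ideal_INT R I JX \<and>
        (embedded_primes R J = {} \<longrightarrow> primary_decomposition R J I JX)"
proof -
  interpret arrangement_with_hyperplane scl x A H \<alpha> \<beta>
    by (rule arrangement_with_hyperplane.intro) (rule assms)+
  show ?thesis
    unfolding Let_def using residue_ideal_decomposition by blast
qed

end
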